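(* Let $\mathbb{X}^d$ be the Euclidean space $\mathbb{E}^d$, the sphere $\mathbb{S}^d$, or the hyperbolic space $\mathbb{H}^d$, and let $(\Gamma,p)$ be a framework in $\mathbb{X}^d$. Then the number of kinematic degrees of freedom of $(\Gamma,p)$ equals the number of static degrees of freedom of $(\Gamma,p)$, that is, $$\dim V(\Gamma,p)/V_0(\Gamma,p)=\dim F(\Gamma,p)/F_0(\Gamma,p).$$ In particular, $(\Gamma,p)$ is infinitesimally rigid if and only if it is statically rigid.
   Context: Spaces: $\mathbb{E}^d=\{x\in\mathbb{R}^{d+1}\mid x_0=1\}$; $\mathbb{S}^d=\{x\in\mathbb{R}^{d+1}\mid\langle x,x\rangle=1\}$ with $\langle x,y\rangle=x_0y_0+x_1y_1+\dots+x_dy_d$; $\mathbb{H}^d=\{x\in\mathbb{R}^{d+1}\mid\langle x,x\rangle=-1,\ x_0>0\}$ with $\langle x,y\rangle=-x_0y_0+x_1y_1+\dots+x_dy_d$; each with its usual Riemannian metric and distance $\operatorname{dist}$. Frameworks: $\Gamma$ is a finite simple graph with vertex set $\Gamma_0$ and edge set $\Gamma_1$ (an edge $\{i,j\}$ is written $ij$). A framework $(\Gamma,p)$ in $\mathbb{X}^d$ is $\Gamma$ with a map $p\colon\Gamma_0\to\mathbb{X}^d$, $i\mapsto p_i$, such that $p_i\ne p_j$ for every $ij\in\Gamma_1$; if $\mathbb{X}=\mathbb{S}$, additionally $p_i\neq -p_j$ for every $ij\in\Gamma_1$. Kinematics: A vector field on $(\Gamma,p)$ is a map $i\mapsto q_i\in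 T_{p_i}\mathbb{X}^d$. It is an infinitesimal isometric deformation if for some (equivalently, every) smooth family $(\Gamma,p(t))$ with $p(0)=p$ and $\frac{d}{dt}|_{t=0}p_i(t)=q_i$ for all $i$ one has $\frac{d}{dt}|_{t=0}\operatorname{dist}(p_i(t),p_j(t))=0$ for all $ij\in\Gamma_1$. It is trivial if there is a Killing field $K$ on $\mathbb{X}^d$ with $q_i=K(p_i)$ for all $i$. $V(\Gamma,p)$ and $V_0(\Gamma,p)$ are the vector spaces of all, respectively trivial, infinitesimal isometric deformations. The number of kinematic degrees of freedom is $\dim V(\Gamma,p)/V_0(\Gamma,p)$; $(\Gamma,p)$ is infinitesimally rigid if this is $0$. Statics: A force is a pair $(p,f)$ with $p\in\mathbb{X}^d$, $f\in T_p\mathbb{X}^d$. A system of forces is a finite formal sum of forces, considered up to the equivalence generated by: $(p,0)\sim0$; $\lambda_1(p,f_1)+\lambda_2(p,f_2)\sim(p,\lambda_1f_1+\lambda_2f_2)$; $(p,f)\sim(\exp_p(\lambda f),\tau(f))$ for $\lambda\in\mathbb{R}$, where $\tau$ is parallel transport along the geodesic $s\mapsto \exp_p(sf)$ from $p$ to $\exp_p(\lambda f)$ (in $\mathbb{E}^d$: $(p,f)\sim(p+\lambda f,f)$). A load on $(\Gamma,p)$ is a map $i\mapsto f_i\in T_{p_i}\mathbb{X}^d$. It is an equilibrium load if $\sum_{i\in\Gamma_0}(p_i,f_i)\sim 0$. A stress is a map $w\colon\Gamma_1\to\mathbb{R}$, $ij\mapsto w_{ij}=w_{ji}$; it resolves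 the load $f$ if for every $i\in\Gamma_0$ $$f_i=\sum_{j:\,ij\in\Gamma_1}w_{ij}\operatorname{dist}(p_i,p_j)\,e_{ij},$$ where $e_{ij}\in T_{p_i}\mathbb{X}^d$ is the unit vector at $p_i$ pointing along the minimizing geodesic towards $p_j$ (in $\mathbb{E}^d$ this reads $f_i=\sum_j w_{ij}(p_j-p_i)$). $F(\Gamma,p)$ is the vector space of equilibrium loads and $F_0(\Gamma,p)\subset F(\Gamma,p)$ the subspace of resolvable loads (those resolved by some stress). The number of static degrees of freedom is $\dim F(\Gamma,p)/F_0(\Gamma,p)$; $(\Gamma,p)$ is statically rigid if this is $0$. *)

theory Defs
  imports "HOL-Analysis.Analysis" "HOL-Library.Poly_Mapping"
begin

section \<open>The spaces of constant curvature\<close>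

text \<open>
  The ambient space \<open>\<real>\<^bsup>d+1\<^esup>\<close> is \<open>'n rvec\<close> with \<open>CARD('n) = d + 1\<close>. The class \<open>zero\<close> only
  serves to single out one index, so that \<open>x $ 0\<close> is the coordinate \<open>x\<^sub>0\<close>; nothing is assumed
  about it. The case \<open>d = 0\<close> is included.
\<close>

type_synonym 'n rvec = "(real, 'n) vec"

datatype geometry = Euclidean | Spherical | Hyperbolic

definition form :: "geometry \<Rightarrow> 'n::{finite,zero} rvec \<Rightarrow> 'n rvec \<Rightarrow> real" where
  "form G x y = (if G = Hyperbolic then - (x $ 0 * y $ 0) else x $ 0 * y $ 0)
     + (\<Sum>i\<in>UNIV - {0}. x $ i * y $ i)"

fun points :: "geometry \<Rightarrow> 'n::{finite,zero} rvec set" where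
  "points Euclidean = {x. x $ 0 = 1}"
| "points Spherical = {x. form Spherical x x = 1}"
| "points Hyperbolic = {x. form Hyperbolic x x = -1 \<and> x $ 0 > 0}"

fun tangent :: "geometry \<Rightarrow> 'n::{finite,zero} rvec \<Rightarrow> 'n rvec set" where
  "tangent Euclidean x = {v. v $ 0 = 0}"
| "tangent Spherical x = {v. form Spherical x v = 0}"
| "tangent Hyperbolic x = {v. form Hyperbolic x v = 0}"

text \<open>
  In all three cases the Riemannian metric is the restriction of \<open>form G\<close> to the tangent spaces
  (tangent vectors of the Euclidean model have vanishing \<open>0\<close>-th coordinate).
\<close>

definition tnorm :: "geometry \<Rightarrow> 'n::{finite,zero} rvec \<Rightarrow> real" where
  "tnorm G v = sqrt (form G v v)"

fun rdist :: "geometry \<Rightarrow> 'n::{finite,zero} rvec \<Rightarrow> 'n rvec \<Rightarrow> real" where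
  "rdist Euclidean x y = dist x y"
| "rdist Spherical x y = arccos (form Spherical x y)"
| "rdist Hyperbolic x y = arcosh (- form Hyperbolic x y)"

text \<open>For \<open>v = 0\<close> the quotients below are \<open>0\<close>, so \<open>expmap G x 0 = x\<close> as required.\<close>

fun expmap :: "geometry \<Rightarrow> 'n::{finite,zero} rvec \<Rightarrow> 'n rvec \<Rightarrow> 'n rvec" where
  "expmap Euclidean x v = x + v"
| "expmap Spherical x v = cos (tnorm Spherical v) *\<^sub>R x
     + (sin (tnorm Spherical v) / tnorm Spherical v) *\<^sub>R v"
| "expmap Hyperbolic x v = cosh (tnorm Hyperbolic v) *\<^sub>R x
     + (sinh (tnorm Hyperbolic v) / tnorm Hyperbolic v) *\<^sub>R v"

text \<open>
  The covariant derivative of the induced metric is the tangential part of the ambient derivative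
  with respect to \<open>form G\<close>. Hence a tangent field along a curve is parallel iff its ambient
  derivative is orthogonal to the tangent spaces.
\<close>

definition parallel_along ::
  "geometry \<Rightarrow> (real \<Rightarrow> 'n::{finite,zero} rvec) \<Rightarrow> (real \<Rightarrow> 'n rvec) \<Rightarrow> bool" where
  "parallel_along G \<gamma> X \<longleftrightarrow> (\<forall>s. X s \<in> tangent G (\<gamma> s) \<and>
     (\<exists>X'. (X has_vector_derivative X') (at s) \<and> (\<forall>u\<in>tangent G (\<gamma> s). form G X' u = 0)))"

text \<open>
  The unit vector at \<open>x\<close> pointing along the minimizing geodesic towards \<open>y\<close>. It is unique if
  \<open>x \<noteq> y\<close> and, on the sphere, \<open>x \<noteq> - y\<close>.
\<close>

definition direction :: "geometry \<Rightarrow> 'n::{finite,zero} rvec \<Rightarrow> 'n rvec \<Rightarrow> 'n rvec" where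
  "direction G x y =
     (THE e. e \<in> tangent G x \<and> tnorm G e = 1 \<and> expmap G x (rdist G x y *\<^sub>R e) = y)"


section \<open>Smoothness and Killing fields\<close>

text \<open>
  \<open>C\<^sup>k\<close> maps on an open subset of a finite-dimensional space; there, continuity of all directional
  derivatives \<open>\<lambda>x. f' x v\<close> amounts to continuity of \<open>f'\<close>.
\<close>

primrec Ck_on :: "nat \<Rightarrow> 'a::real_normed_vector set \<Rightarrow> ('a \<Rightarrow> 'b::real_normed_vector) \<Rightarrow> bool" where
  "Ck_on 0 U f \<longleftrightarrow> continuous_on U f"
| "Ck_on (Suc k) U f \<longleftrightarrow> (\<exists>f'. (\<forall>x\<in>U. (f has_derivative f' x) (at x)) \<and>
     (\<forall>v. Ck_on k U (\<lambda>x. f' x v)))"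

definition smooth_on :: "'a::real_normed_vector set \<Rightarrow> ('a \<Rightarrow> 'b::real_normed_vector) \<Rightarrow> bool" where
  "smooth_on U f \<longleftrightarrow> (\<forall>k. Ck_on k U f)"

text \<open>
  A vector field on the space is represented by a smooth extension to an open neighbourhood. The
  last clause is the Killing equation \<open>\<langle>\<nabla>\<^sub>u K, v\<rangle> + \<langle>u, \<nabla>\<^sub>v K\<rangle> = 0\<close>: the normal parts of the ambient
  derivatives do not contribute, since \<open>u\<close> and \<open>v\<close> are tangent.
\<close>

definition killing_field :: "geometry \<Rightarrow> ('n::{finite,zero} rvec \<Rightarrow> 'n rvec) \<Rightarrow> bool" where
  "killing_field G K \<longleftrightarrow>
     (\<exists>U. open U \<and> points G \<subseteq> U \<and> smooth_on U K) \<and>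
     (\<forall>x\<in>points G. K x \<in> tangent G x) \<and>
     (\<forall>x\<in>points G. \<forall>u\<in>tangent G x. \<forall>v\<in>tangent G x.
        form G (frechet_derivative K (at x) u) v + form G u (frechet_derivative K (at x) v) = 0)"


section \<open>Frameworks\<close>

text \<open>The vertex set of a graph is a finite type; edges are two-element sets of vertices.\<close>

definition framework ::
  "geometry \<Rightarrow> 'v::finite set set \<Rightarrow> ('v \<Rightarrow> 'n::{finite,zero} rvec) \<Rightarrow> bool" where
  "framework G E p \<longleftrightarrow>
     (\<forall>e\<in>E. card e = 2) \<and>
     (\<forall>i. p i \<in> points G) \<and>
     (\<forall>i j. {i, j} \<in> E \<longrightarrow> p i \<noteq> p j \<and> (G = Spherical \<longrightarrow> p i \<noteq> - p j))"


section \<open>Dimension of a quotient space\<close>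

text \<open>
  \<open>B \<subseteq> V\<close> represents a basis of \<open>V / W\<close>: the classes of the elements of \<open>B\<close> are linearly
  independent (in particular distinct) and span \<open>V / W\<close>. Only finite-dimensional spaces occur.
\<close>

definition quotient_basis :: "'a::real_vector set \<Rightarrow> 'a set \<Rightarrow> 'a set \<Rightarrow> bool" where
  "quotient_basis V W B \<longleftrightarrow> finite B \<and> B \<subseteq> V \<and>
     (\<forall>c. (\<Sum>b\<in>B. c b *\<^sub>R b) \<in> W \<longrightarrow> (\<forall>b\<in>B. c b = 0)) \<and>
     (\<forall>x\<in>V. \<exists>c. x - (\<Sum>b\<in>B. c b *\<^sub>R b) \<in> W)"

definition quotient_dim :: "'a::real_vector set \<Rightarrow> 'a set \<Rightarrow> nat" where
  "quotient_dim V W = card (SOME B. quotient_basis V W B)"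


section \<open>Kinematics\<close>

text \<open>
  Vector fields and loads on a framework are elements of \<open>'n rvec ^ 'v\<close>.
\<close>

definition tangent_fields ::
  "geometry \<Rightarrow> ('v::finite \<Rightarrow> 'n::{finite,zero} rvec) \<Rightarrow> ('n rvec ^ 'v) set" where
  "tangent_fields G p = {q. \<forall>i. q $ i \<in> tangent G (p i)}"

definition isometric_deformations ::
  "geometry \<Rightarrow> 'v::finite set set \<Rightarrow> ('v \<Rightarrow> 'n::{finite,zero} rvec) \<Rightarrow> ('n rvec ^ 'v) set" where
  "isometric_deformations G E p = {q \<in> tangent_fields G p.
     \<exists>P \<epsilon>. \<epsilon> > 0 \<and>
       (\<forall>i. smooth_on {-\<epsilon><..<\<epsilon>} (P i)) \<and>
       (\<forall>t\<in>{-\<epsilon><..<\<epsilon>}. framework G E (\<lambda>i. P i t)) \<and>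
       (\<forall>i. P i 0 = p i \<and> (P i has_vector_derivative q $ i) (at 0)) \<and>
       (\<forall>i j. {i, j} \<in> E \<longrightarrow>
          ((\<lambda>t. rdist G (P i t) (P j t)) has_real_derivative 0) (at 0))}"

definition trivial_deformations ::
  "geometry \<Rightarrow> 'v::finite set set \<Rightarrow> ('v \<Rightarrow> 'n::{finite,zero} rvec) \<Rightarrow> ('n rvec ^ 'v) set" where
  "trivial_deformations G E p =
     {q \<in> isometric_deformations G E p. \<exists>K. killing_field G K \<and> (\<forall>i. q $ i = K (p i))}"

definition kinematic_dof ::
  "geometry \<Rightarrow> 'v::finite set set \<Rightarrow> ('v \<Rightarrow> 'n::{finite,zero} rvec) \<Rightarrow> nat" where
  "kinematic_dof G E p = quotient_dim (isometric_deformations G E p) (trivial_deformations G E p)"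

definition infinitesimally_rigid ::
  "geometry \<Rightarrow> 'v::finite set set \<Rightarrow> ('v \<Rightarrow> 'n::{finite,zero} rvec) \<Rightarrow> bool" where
  "infinitesimally_rigid G E p \<longleftrightarrow> kinematic_dof G E p = 0"


section \<open>Statics\<close>

text \<open>
  Formal sums of forces, with real coefficients, are finitely supported functions on pairs
  \<open>(x, f)\<close>; \<open>Poly_Mapping.single (x, f) r\<close> is \<open>r (x, f)\<close>.
\<close>

type_synonym 'n force_sum = "('n rvec \<times> 'n rvec) \<Rightarrow>\<^sub>0 real"

definition forces :: "geometry \<Rightarrow> ('n::{finite,zero} rvec \<times> 'n rvec) set" where
  "forces G = {(x, f). x \<in> points G \<and> f \<in> tangent G x}"

text \<open>
  The least equivalence relation compatible with addition that contains the three kinds of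
  generators. Compatibility with multiplication by scalars follows. In \<open>transport\<close>, \<open>X r\<close> is the
  parallel transport of \<open>f\<close> along the geodesic \<open>s \<mapsto> exp\<^sub>x(s f)\<close> to \<open>exp\<^sub>x(r f)\<close>.
\<close>

inductive force_equiv ::
  "geometry \<Rightarrow> ('n::{finite,zero}) force_sum \<Rightarrow> 'n force_sum \<Rightarrow> bool" for G where
  refl: "Poly_Mapping.keys a \<subseteq> forces G \<Longrightarrow> force_equiv G a a"
| sym: "force_equiv G a b \<Longrightarrow> force_equiv G b a"
| trans: "force_equiv G a b \<Longrightarrow> force_equiv G b c \<Longrightarrow> force_equiv G a c"
| add: "force_equiv G a b \<Longrightarrow> force_equiv G c d \<Longrightarrow> force_equiv G (a + c) (b + d)"
| null: "x \<in> points G \<Longrightarrow> force_equiv G (Poly_Mapping.single (x, 0) 1) 0"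
| combine: "(x, f\<^sub>1) \<in> forces G \<Longrightarrow> (x, f\<^sub>2) \<in> forces G \<Longrightarrow>
    force_equiv G (Poly_Mapping.single (x, f\<^sub>1) r\<^sub>1 + Poly_Mapping.single (x, f\<^sub>2) r\<^sub>2)
      (Poly_Mapping.single (x, r\<^sub>1 *\<^sub>R f\<^sub>1 + r\<^sub>2 *\<^sub>R f\<^sub>2) 1)"
| transport: "(x, f) \<in> forces G \<Longrightarrow> parallel_along G (\<lambda>s. expmap G x (s *\<^sub>R f)) X \<Longrightarrow> X 0 = f \<Longrightarrow>
    force_equiv G (Poly_Mapping.single (x, f) 1)
      (Poly_Mapping.single (expmap G x (r *\<^sub>R f), X r) 1)"

definition equilibrium_loads ::
  "geometry \<Rightarrow> ('v::finite \<Rightarrow> 'n::{finite,zero} rvec) \<Rightarrow> ('n rvec ^ 'v) set" where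
  "equilibrium_loads G p =
     {f \<in> tangent_fields G p. force_equiv G (\<Sum>i\<in>UNIV. Poly_Mapping.single (p i, f $ i) 1) 0}"

text \<open>A stress is a function on edges, so \<open>w\<^sub>i\<^sub>j = w\<^sub>j\<^sub>i\<close> holds by construction.\<close>

definition resolves :: "geometry \<Rightarrow> 'v::finite set set \<Rightarrow> ('v \<Rightarrow> 'n::{finite,zero} rvec) \<Rightarrow>
    ('v set \<Rightarrow> real) \<Rightarrow> 'n rvec ^ 'v \<Rightarrow> bool" where
  "resolves G E p w f \<longleftrightarrow> (\<forall>i. f $ i =
     (\<Sum>j | {i, j} \<in> E. (w {i, j} * rdist G (p i) (p j)) *\<^sub>R direction G (p i) (p j)))"

definition resolvable_loads ::
  "geometry \<Rightarrow> 'v::finite set set \<Rightarrow> ('v \<Rightarrow> 'n::{finite,zero} rvec) \<Rightarrow> ('n rvec ^ 'v) set" where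
  "resolvable_loads G E p = {f \<in> equilibrium_loads G p. \<exists>w. resolves G E p w f}"

definition static_dof ::
  "geometry \<Rightarrow> 'v::finite set set \<Rightarrow> ('v \<Rightarrow> 'n::{finite,zero} rvec) \<Rightarrow> nat" where
  "static_dof G E p = quotient_dim (equilibrium_loads G p) (resolvable_loads G E p)"

definition statically_rigid ::
  "geometry \<Rightarrow> 'v::finite set set \<Rightarrow> ('v \<Rightarrow> 'n::{finite,zero} rvec) \<Rightarrow> bool" where
  "statically_rigid G E p \<longleftrightarrow> static_dof G E p = 0"

end

theory Submission
  imports Defs
begin

text \<open>
  Both numbers are codimensions of pairs of annihilators. Let \<open>T\<close> be the space of all vector fields on
  the framework, with the positive definite pairing \<open>\<langle>q, f\<rangle> = \<Sum>\<^sub>i \<langle>q\<^sub>i, f\<^sub>i\<rangle>\<close> (\<open>work\<close>). The theorem follows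
  from two dualities.

  The isometric deformations are the annihilator of the loads resolved by some stress
  (\<open>isometric_deformations_annihilator\<close>), because the derivative of the length of an edge is, up to a
  factor, the pairing with the load of a unit stress on that edge. The equilibrium loads are the
  annihilator of the trivial deformations (\<open>equilibrium_loads_annihilator\<close>).

  The second duality is the substantial one. A force \<open>(x, f)\<close> is determined up to equivalence by the
  bivector \<open>x \<and> f\<close>. Invariants of the equivalence come from Killing fields \<open>K\<close>: the product of \<open>K\<close> with
  the velocity of a geodesic is constant, so \<open>\<langle>f, K x\<rangle>\<close> does not change when a force slides along its
  line (\<open>force_equiv_killing_pairing\<close>). Conversely, sliding realises the relation
  \<open>x \<and> y = - y \<and> x\<close> for points \<open>x\<close> and \<open>y\<close> (\<open>point_force_slide\<close>), and with a basis of the ambient space that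
  consists of points every system of forces with vanishing total bivector reduces to zero
  (\<open>force_equiv_zeroI\<close>); rotations and translations suffice to detect that bivector.

  Killing fields preserve distances infinitesimally, so the trivial deformations lie in the space
  \<open>V\<close> of isometric ones, and dually the resolved loads lie in the space \<open>F\<close> of equilibrium loads. Counting
  dimensions with \<open>V\<^sub>0\<close> for the trivial deformations and \<open>F\<^sub>0\<close> for the resolved loads,
  \<open>dim V - dim V\<^sub>0 = (dim T - dim F\<^sub>0) - (dim T - dim F) = dim F - dim F\<^sub>0\<close>.

  The three geometries are treated together through the curvature \<open>\<kappa> = 0, 1, -1\<close>: points and tangent
  spaces are described by the form \<open>coform\<close>, and geodesics by generalised trigonometric functions.
\<close>

section \<open>Uniform description of the three geometries\<close>

definition curv :: "geometry \<Rightarrow> real" where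
  "curv G = (case G of Euclidean \<Rightarrow> 0 | Spherical \<Rightarrow> 1 | Hyperbolic \<Rightarrow> -1)"

text \<open>
  For curvature \<open>\<kappa> = 1\<close> or \<open>\<kappa> = -1\<close> this is \<open>\<kappa>\<close> times the ambient form, and for \<open>\<kappa> = 0\<close> it is the limit
  \<open>x\<^sub>0 y\<^sub>0\<close>. In all three geometries the points satisfy \<open>coform G x x = 1\<close> and the tangent vectors at \<open>x\<close>
  satisfy \<open>coform G x v = 0\<close>, so that most arguments below are uniform in \<open>\<kappa>\<close>.
\<close>

definition coform :: "geometry \<Rightarrow> 'n::{finite,zero} rvec \<Rightarrow> 'n rvec \<Rightarrow> real" where
  "coform G x y = x $ 0 * y $ 0 + curv G * (x \<bullet> y - x $ 0 * y $ 0)"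

text \<open>
  The projection onto the tangent space at \<open>x\<close> along \<open>x\<close> itself. For a point \<open>y\<close> it gives a
  tangent vector at \<open>x\<close> that, unless it is zero, points along the geodesic towards \<open>y\<close>; in Euclidean
  space it is \<open>y - x\<close>.
\<close>

definition proj :: "geometry \<Rightarrow> 'n::{finite,zero} rvec \<Rightarrow> 'n rvec \<Rightarrow> 'n rvec" where
  "proj G x v = v - coform G x v *\<^sub>R x"

text \<open>
  Solutions of \<open>u'' = - \<kappa> u\<close>: they describe unit speed geodesics as \<open>gcos s x + gsin s e\<close>.
\<close>

definition gcos :: "geometry \<Rightarrow> real \<Rightarrow> real" where
  "gcos G t = (case G of Euclidean \<Rightarrow> 1 | Spherical \<Rightarrow> cos t | Hyperbolic \<Rightarrow> cosh t)"

definition gsin :: "geometry \<Rightarrow> real \<Rightarrow> real" where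
  "gsin G t = (case G of Euclidean \<Rightarrow> t | Spherical \<Rightarrow> sin t | Hyperbolic \<Rightarrow> sinh t)"

lemma form_eq_inner:
  fixes x y :: "'n::{finite,zero} rvec"
  shows "form G x y = x \<bullet> y - (if G = Hyperbolic then 2 * (x $ 0 * y $ 0) else 0)"
proof -
  have "x \<bullet> y = x $ 0 * y $ 0 + (\<Sum>i\<in>UNIV - {0}. x $ i * y $ i)"
    by (simp add: inner_vec_def sum.remove[of UNIV 0])
  then show ?thesis by (simp add: form_def)
qed

lemma bilinear_form: "bilinear (form G)"
  unfolding form_eq_inner
  by (auto simp: bilinear_def inner_add_left inner_add_right algebra_simps intro!: linearI)

lemma bounded_bilinear_form: "bounded_bilinear (form G)"
  using bilinear_form by (simp add: bilinear_conv_bounded_bilinear)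

interpretation form: bounded_bilinear "form G" for G
  by (rule bounded_bilinear_form)

lemma bilinear_coform: "bilinear (coform G)"
  unfolding coform_def
  by (auto simp: bilinear_def inner_add_left inner_add_right algebra_simps intro!: linearI)

interpretation coform: bounded_bilinear "coform G" for G
  using bilinear_coform by (simp add: bilinear_conv_bounded_bilinear)

lemma form_commute: "form G x y = form G y x"
  by (simp add: form_eq_inner inner_commute mult.commute)

lemma coform_commute: "coform G x y = coform G y x"
  by (simp add: coform_def inner_commute mult.commute)

lemma form_eq_coform: "G \<noteq> Euclidean \<Longrightarrow> form G x y = curv G * coform G x y"
  by (cases G) (auto simp: form_eq_inner coform_def curv_def)

lemma points_iff: "x \<in> points G \<longleftrightarrow> coform G x x = 1 \<and> (G = Spherical \<or> x $ 0 > 0)"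
proof (cases G)
  case Euclidean
  have "x $ 0 * x $ 0 = 1 \<and> x $ 0 > 0 \<longleftrightarrow> x $ 0 = 1"
    using square_eq_1_iff[of "x $ 0"] by auto
  then show ?thesis using Euclidean by (simp add: coform_def curv_def)
qed (auto simp: form_eq_inner coform_def curv_def)

lemma tangent_iff: "x \<in> points G \<Longrightarrow> v \<in> tangent G x \<longleftrightarrow> coform G x v = 0"
  by (cases G) (auto simp: form_eq_inner coform_def curv_def mult.commute)

lemma subspace_tangent: "x \<in> points G \<Longrightarrow> subspace (tangent G x)"
  by (simp add: subspace_def tangent_iff coform.zero_right coform.add_right coform.scaleR_right)

text \<open>
  A point is orthogonal to its tangent space if \<open>\<kappa> \<noteq> 0\<close>. The factor \<open>\<kappa>\<close> makes the statement uniform,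
  and it is harmless because the acceleration of a geodesic carries this factor.
\<close>

lemma curv_form_tangent: "x \<in> points G \<Longrightarrow> v \<in> tangent G x \<Longrightarrow> curv G * form G x v = 0"
  by (cases "G = Euclidean") (simp_all add: curv_def form_eq_coform tangent_iff)

text \<open>
  Cauchy-Schwarz for the parts of the vectors with the coordinate \<open>0\<close> removed. It is the source of all
  sign statements in the hyperbolic case.
\<close>

lemma spatial_Cauchy_Schwarz:
  fixes x y :: "'n::{finite,zero} rvec"
  shows "(x \<bullet> y - x $ 0 * y $ 0)\<^sup>2 \<le> (x \<bullet> x - x $ 0 * x $ 0) * (y \<bullet> y - y $ 0 * y $ 0)"
    and "x $ 0 * x $ 0 \<le> x \<bullet> x"
proof -
  define s :: "'n rvec \<Rightarrow> 'n rvec" where "s z = z - axis 0 (z $ 0)" for z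
  have eq: "s u \<bullet> s v = u \<bullet> v - u $ 0 * v $ 0" for u v
    by (simp add: s_def inner_diff_left inner_diff_right inner_axis inner_axis' axis_nth)
  show "(x \<bullet> y - x $ 0 * y $ 0)\<^sup>2 \<le> (x \<bullet> x - x $ 0 * x $ 0) * (y \<bullet> y - y $ 0 * y $ 0)"
    using Cauchy_Schwarz_ineq[of "s x" "s y"] by (simp add: eq)
  show "x $ 0 * x $ 0 \<le> x \<bullet> x"
    using inner_ge_zero[of "s x"] by (simp add: eq)
qed

text \<open>
  Tangency expresses \<open>x\<^sub>0 v\<^sub>0\<close> as the product of the spatial parts of \<open>x\<close> and \<open>v\<close>, which Cauchy-Schwarz
  bounds. The inequality shows that tangent vectors of the hyperboloid are spacelike, and that
  geodesics stay on the upper sheet.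
\<close>

lemma hyperbolic_tangent_bound:
  assumes "x \<in> points Hyperbolic" "v \<in> tangent Hyperbolic x"
  shows "(v $ 0)\<^sup>2 \<le> ((x $ 0)\<^sup>2 - 1) * form Hyperbolic v v"
proof -
  have xx: "x \<bullet> x = 2 * (x $ 0)\<^sup>2 - 1" and xv: "x \<bullet> v = 2 * (x $ 0 * v $ 0)"
    using assms by (auto simp: form_eq_inner power2_eq_square)
  have "(x $ 0 * v $ 0)\<^sup>2 \<le> ((x $ 0)\<^sup>2 - 1) * (v \<bullet> v - (v $ 0)\<^sup>2)"
    using spatial_Cauchy_Schwarz(1)[of x v] by (simp add: xx xv power2_eq_square ac_simps)
  then show ?thesis
    by (simp add: form_eq_inner algebra_simps power2_eq_square)
qed

lemma form_pos:
  assumes x: "x \<in> points G" and v: "v \<in> tangent G x" "v \<noteq> 0"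
  shows "form G v v > 0"
proof (cases "G = Hyperbolic")
  case False
  then show ?thesis using v by (simp add: form_eq_inner)
next
  case True
  have b: "(v $ 0)\<^sup>2 \<le> ((x $ 0)\<^sup>2 - 1) * form G v v"
    using hyperbolic_tangent_bound x v True by blast
  have "x \<bullet> x = 2 * (x $ 0 * x $ 0) - 1"
    using x True by (auto simp: form_eq_inner)
  then have x0: "(x $ 0)\<^sup>2 \<ge> 1"
    using spatial_Cauchy_Schwarz(2)[of x] by (simp add: power2_eq_square)
  show ?thesis
  proof (cases "v $ 0 = 0")
    case True
    then show ?thesis using v by (simp add: form_eq_inner)
  next
    case False
    then have "0 < ((x $ 0)\<^sup>2 - 1) * form G v v"
      using b by (meson less_le_trans zero_less_power2)
    then show ?thesis using x0
      by (metis diff_ge_0_iff_ge mult_nonneg_nonpos not_less)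
  qed
qed

lemma form_nonneg:
  assumes "x \<in> points G" "v \<in> tangent G x"
  shows "form G v v \<ge> 0"
  using form_pos[OF assms] by (cases "v = 0") (auto simp: form.zero_right)

lemma tnorm_pos:
  assumes "x \<in> points G" "v \<in> tangent G x" "v \<noteq> 0"
  shows "tnorm G v > 0"
  using form_pos[OF assms] by (simp add: tnorm_def)

lemma tnorm_square:
  assumes "x \<in> points G" "v \<in> tangent G x"
  shows "(tnorm G v)\<^sup>2 = form G v v"
  using form_nonneg[OF assms] by (simp add: tnorm_def)

lemma tnorm_scaleR: "tnorm G (c *\<^sub>R v) = \<bar>c\<bar> * tnorm G v"
proof -
  have "form G (c *\<^sub>R v) (c *\<^sub>R v) = c\<^sup>2 * form G v v"
    by (simp add: form.scaleR_left form.scaleR_right power2_eq_square)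
  then show ?thesis by (simp add: tnorm_def real_sqrt_mult)
qed

lemma tnorm_zero: "tnorm G 0 = 0"
  by (simp add: tnorm_def form.zero_right)

lemma proj_tangent: "x \<in> points G \<Longrightarrow> proj G x v \<in> tangent G x"
  by (simp add: tangent_iff proj_def coform.diff_right coform.scaleR_right points_iff)

lemma proj_eq_self: "x \<in> points G \<Longrightarrow> v \<in> tangent G x \<Longrightarrow> proj G x v = v"
  by (simp add: tangent_iff proj_def)

lemma proj_add: "proj G x (u + v) = proj G x u + proj G x v"
  by (simp add: proj_def coform.add_right algebra_simps)

lemma proj_scaleR: "proj G x (c *\<^sub>R v) = c *\<^sub>R proj G x v"
  by (simp add: proj_def coform.scaleR_right algebra_simps)

lemma proj_zero: "proj G x 0 = 0"
  by (simp add: proj_def coform.zero_right)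

lemma form_proj:
  assumes "G \<noteq> Euclidean" "x \<in> points G" "u \<in> tangent G x"
  shows "form G u (proj G x v) = form G u v"
  using assms by (simp add: proj_def form.diff_right form.scaleR_right form_eq_coform
      tangent_iff coform_commute[of G u x])

section \<open>Distances and directions\<close>

lemma form_proj_self:
  assumes "G \<noteq> Euclidean" "x \<in> points G" "y \<in> points G"
  shows "form G (proj G x y) (proj G x y) = curv G * (1 - (coform G x y)\<^sup>2)"
proof -
  have "form G (proj G x y) (proj G x y) = form G (proj G x y) y"
    by (rule form_proj[OF assms(1,2) proj_tangent[OF assms(2)]])
  also have "\<dots> = curv G * coform G (proj G x y) y"
    by (rule form_eq_coform[OF assms(1)])
  also have "coform G (proj G x y) y = 1 - (coform G x y)\<^sup>2"
    using assms by (simp add: proj_def coform.diff_left coform.scaleR_left points_iff power2_eq_square)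
  finally show ?thesis .
qed

lemma proj_eq_0_iff:
  assumes x: "x \<in> points G" and y: "y \<in> points G"
  shows "proj G x y = 0 \<longleftrightarrow> x = y \<or> (G = Spherical \<and> x = - y)"
proof
  assume "proj G x y = 0"
  then have yx: "y = coform G x y *\<^sub>R x" by (simp add: proj_def)
  then have "coform G y y = (coform G x y)\<^sup>2 * coform G x x"
    by (metis coform.scaleR_left coform.scaleR_right mult.assoc power2_eq_square real_scaleR_def)
  then have "(coform G x y)\<^sup>2 = 1" using x y by (simp add: points_iff)
  then have "coform G x y = 1 \<or> coform G x y = -1" by (simp add: power2_eq_1_iff)
  then show "x = y \<or> (G = Spherical \<and> x = - y)"
  proof
    assume "coform G x y = -1"
    then have "y = - x" using yx by simp
    then show ?thesis using x y by (auto simp: points_iff)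
  qed (use yx in simp)
next
  assume "x = y \<or> (G = Spherical \<and> x = - y)"
  then show "proj G x y = 0"
    using x y by (auto simp: proj_def points_iff coform.minus_left coform.minus_right)
qed

text \<open>
  Both points lie on the upper sheet, so \<open>x\<^sub>0 y\<^sub>0\<close> exceeds the product of the spatial norms
  \<open>sqrt (x\<^sub>0\<^sup>2 - 1) * sqrt (y\<^sub>0\<^sup>2 - 1)\<close>.
\<close>

lemma coform_hyperbolic_pos:
  assumes x: "x \<in> points Hyperbolic" and y: "y \<in> points Hyperbolic"
  shows "coform Hyperbolic x y > 0"
proof -
  have xx: "x \<bullet> x = 2 * (x $ 0 * x $ 0) - 1" "x $ 0 > 0" and yy: "y \<bullet> y = 2 * (y $ 0 * y $ 0) - 1" "y $ 0 > 0"
    using x y by (auto simp: form_eq_inner)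
  have "(x \<bullet> y - x $ 0 * y $ 0)\<^sup>2 \<le> ((x $ 0)\<^sup>2 - 1) * ((y $ 0)\<^sup>2 - 1)"
    using spatial_Cauchy_Schwarz(1)[of x y] by (simp add: xx yy power2_eq_square)
  also have "\<dots> < (x $ 0)\<^sup>2 * (y $ 0)\<^sup>2"
  proof -
    have "(x $ 0)\<^sup>2 \<ge> 1" "(y $ 0)\<^sup>2 \<ge> 1"
      using spatial_Cauchy_Schwarz(2)[of x] spatial_Cauchy_Schwarz(2)[of y] xx yy
      by (simp_all add: power2_eq_square)
    then show ?thesis by (simp add: algebra_simps)
  qed
  also have "\<dots> = (x $ 0 * y $ 0)\<^sup>2" by (simp add: power_mult_distrib)
  finally have "(x \<bullet> y - x $ 0 * y $ 0)\<^sup>2 < (x $ 0 * y $ 0)\<^sup>2" .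
  then have "\<bar>x \<bullet> y - x $ 0 * y $ 0\<bar> < \<bar>x $ 0 * y $ 0\<bar>"
    by (metis real_sqrt_abs real_sqrt_less_iff)
  moreover have "x $ 0 * y $ 0 > 0" by (rule mult_pos_pos[OF xx(2) yy(2)])
  ultimately show ?thesis by (simp add: coform_def curv_def abs_if split: if_splits)
qed

lemma form_proj_self_pos:
  assumes x: "x \<in> points G" and y: "y \<in> points G" and ne: "x \<noteq> y" "G = Spherical \<longrightarrow> x \<noteq> - y"
  shows "form G (proj G x y) (proj G x y) > 0"
  using form_pos[OF x proj_tangent[OF x]] proj_eq_0_iff[OF x y] ne by blast

lemma coform_spherical_bound:
  assumes x: "x \<in> points Spherical" and y: "y \<in> points Spherical" and ne: "x \<noteq> y" "x \<noteq> - y"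
  shows "\<bar>coform Spherical x y\<bar> < 1"
    and "tnorm Spherical (proj Spherical x y) = sqrt (1 - (coform Spherical x y)\<^sup>2)"
  using form_proj_self_pos[OF x y] form_proj_self[OF _ x y] ne
  by (simp_all add: tnorm_def curv_def abs_square_less_1)

lemma coform_hyperbolic_bound:
  assumes x: "x \<in> points Hyperbolic" and y: "y \<in> points Hyperbolic" and ne: "x \<noteq> y"
  shows "coform Hyperbolic x y > 1"
    and "tnorm Hyperbolic (proj Hyperbolic x y) = sqrt ((coform Hyperbolic x y)\<^sup>2 - 1)"
proof -
  have "(coform Hyperbolic x y)\<^sup>2 > 1"
    using form_proj_self_pos[OF x y] form_proj_self[OF _ x y] ne by (simp add: curv_def)
  then show "coform Hyperbolic x y > 1"
    using coform_hyperbolic_pos[OF x y] by (metis abs_of_pos abs_square_le_1 not_le)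
  show "tnorm Hyperbolic (proj Hyperbolic x y) = sqrt ((coform Hyperbolic x y)\<^sup>2 - 1)"
    using form_proj_self[OF _ x y] by (simp add: tnorm_def curv_def)
qed

text \<open>
  The geodesic from \<open>x\<close> to \<open>y\<close> has the initial velocity \<open>proj G x y\<close> up to a positive factor; these
  identities say that running along it for the time \<open>rdist G x y\<close> ends in \<open>y\<close>.
\<close>

lemma rdist_properties:
  assumes x: "x \<in> points G" and y: "y \<in> points G" and ne: "x \<noteq> y" "G = Spherical \<longrightarrow> x \<noteq> - y"
  shows "gcos G (rdist G x y) = coform G x y"
    and "gsin G (rdist G x y) = tnorm G (proj G x y)"
    and "rdist G x y > 0"
    and "tnorm G (proj G x y) > 0"
proof -
  show "tnorm G (proj G x y) > 0"
    using form_proj_self_pos[OF assms] by (simp add: tnorm_def)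
  have "gcos G (rdist G x y) = coform G x y \<and> gsin G (rdist G x y) = tnorm G (proj G x y) \<and> rdist G x y > 0"
  proof (cases G)
    case Euclidean
    then have "coform G x y = 1" using x y by (simp add: coform_def curv_def)
    moreover from this have "tnorm G (proj G x y) = dist x y"
      using Euclidean by (simp add: tnorm_def form_eq_inner proj_def dist_norm norm_eq_sqrt_inner
          inner_diff_left inner_diff_right inner_commute)
    ultimately show ?thesis using Euclidean ne by (simp add: gcos_def gsin_def)
  next
    case Spherical
    have c: "-1 < coform G x y" "coform G x y < 1"
      using coform_spherical_bound(1) x y ne Spherical by (auto simp: abs_less_iff)
    have "form Spherical x y = coform G x y" using Spherical by (simp add: form_eq_coform curv_def)
    moreover have "tnorm G (proj G x y) = sqrt (1 - (coform G x y)\<^sup>2)"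
      using coform_spherical_bound(2) x y ne Spherical by auto
    ultimately show ?thesis
      using Spherical c arccos_lt_bounded[OF c] by (simp add: gcos_def gsin_def sin_arccos)
  next
    case Hyperbolic
    have c: "coform G x y > 1"
      using coform_hyperbolic_bound(1) x y ne Hyperbolic by auto
    have "form Hyperbolic x y = - coform G x y" using Hyperbolic by (simp add: form_eq_coform curv_def)
    moreover have "tnorm G (proj G x y) = sqrt ((coform G x y)\<^sup>2 - 1)"
      using coform_hyperbolic_bound(2) x y ne Hyperbolic by auto
    ultimately show ?thesis
      using Hyperbolic c by (simp add: gcos_def gsin_def sinh_arcosh_real)
  qed
  then show "gcos G (rdist G x y) = coform G x y" "gsin G (rdist G x y) = tnorm G (proj G x y)" "rdist G x y > 0"
    by auto
qed

lemma gcos_gsin: "(gcos G t)\<^sup>2 + curv G * (gsin G t)\<^sup>2 = 1"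
  by (cases G) (simp_all add: gcos_def gsin_def curv_def cosh_square_eq)

lemma gcos_derivative: "(gcos G has_real_derivative (- curv G * gsin G t)) (at t)"
  unfolding gcos_def[abs_def] gsin_def[abs_def] curv_def
  by (cases G) (auto intro!: derivative_eq_intros)

lemma gsin_derivative: "(gsin G has_real_derivative (gcos G t)) (at t)"
  unfolding gcos_def[abs_def] gsin_def[abs_def] curv_def
  by (cases G) (auto intro!: derivative_eq_intros)

lemma gcos_gsin_zero: "gcos G 0 = 1" "gsin G 0 = 0"
  by (cases G; simp add: gcos_def gsin_def)+

lemma expmap_eq:
  assumes n: "tnorm G f > 0"
  shows "expmap G x (s *\<^sub>R f) = gcos G (s * tnorm G f) *\<^sub>R x + (gsin G (s * tnorm G f) / tnorm G f) *\<^sub>R f"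
proof (cases "s \<ge> 0")
  case True
  then show ?thesis using n by (cases G; cases "s = 0") (auto simp: tnorm_scaleR tnorm_zero gcos_def gsin_def)
next
  case False
  then have t: "tnorm G (s *\<^sub>R f) = - (s * tnorm G f)" by (simp add: tnorm_scaleR)
  show ?thesis using n False by (cases G) (auto simp: t[simplified] gcos_def gsin_def tnorm_scaleR)
qed

text \<open>
  The equation \<open>expmap G x (rdist G x y *\<^sub>R e) = y\<close> with unit \<open>e\<close> reads \<open>y = gcos r x + gsin r e\<close>, which
  has exactly one solution as \<open>gsin r > 0\<close>.
\<close>

lemma direction_eq:
  assumes x: "x \<in> points G" and y: "y \<in> points G" and ne: "x \<noteq> y" "G = Spherical \<longrightarrow> x \<noteq> - y"
  shows "direction G x y = (1 / tnorm G (proj G x y)) *\<^sub>R proj G x y"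
proof -
  note r = rdist_properties[OF assms]
  let ?n = "tnorm G (proj G x y)"
  have y_eq: "y = coform G x y *\<^sub>R x + proj G x y" by (simp add: proj_def)
  have ex: "expmap G x (rdist G x y *\<^sub>R e) = coform G x y *\<^sub>R x + ?n *\<^sub>R e" if "tnorm G e = 1" for e
    using expmap_eq[of G e x "rdist G x y"] that r by simp
  show ?thesis unfolding direction_def
  proof (rule the_equality)
    have unit: "tnorm G ((1 / ?n) *\<^sub>R proj G x y) = 1" using r(4) by (simp add: tnorm_scaleR)
    moreover have "(1 / ?n) *\<^sub>R proj G x y \<in> tangent G x"
      using proj_tangent[OF x] subspace_tangent[OF x] subspace_scale by blast
    moreover have "expmap G x (rdist G x y *\<^sub>R (1 / ?n) *\<^sub>R proj G x y) = y"
      using ex[OF unit] r(4) y_eq[symmetric] by simp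
    ultimately show "(1 / ?n) *\<^sub>R proj G x y \<in> tangent G x \<and> tnorm G ((1 / ?n) *\<^sub>R proj G x y) = 1 \<and>
      expmap G x (rdist G x y *\<^sub>R (1 / ?n) *\<^sub>R proj G x y) = y"
      using unit by blast
  next
    fix e assume e: "e \<in> tangent G x \<and> tnorm G e = 1 \<and> expmap G x (rdist G x y *\<^sub>R e) = y"
    then have "coform G x y *\<^sub>R x + ?n *\<^sub>R e = coform G x y *\<^sub>R x + proj G x y"
      using ex y_eq by metis
    then have "?n *\<^sub>R e = proj G x y" by simp
    then show "e = (1 / ?n) *\<^sub>R proj G x y" using r(4)
      by (metis divide_self_if less_irrefl real_vector.scale_one scaleR_scaleR times_divide_eq_left mult_1)
  qed
qed

lemma rdist_commute: "rdist G x y = rdist G y x"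
  by (cases G) (simp_all add: dist_commute form_commute)

lemma tnorm_proj_commute:
  assumes x: "x \<in> points G" and y: "y \<in> points G" and ne: "x \<noteq> y" "G = Spherical \<longrightarrow> x \<noteq> - y"
  shows "tnorm G (proj G x y) = tnorm G (proj G y x)"
  using rdist_properties(2)[OF assms] rdist_properties(2)[OF y x] ne rdist_commute[of G x y]
  by (metis minus_equation_iff)

section \<open>Geodesics and parallel transport\<close>

definition geodesic_velocity :: "geometry \<Rightarrow> 'n::{finite,zero} rvec \<Rightarrow> 'n rvec \<Rightarrow> real \<Rightarrow> 'n rvec" where
  "geodesic_velocity G x f s = gcos G (s * tnorm G f) *\<^sub>R f - (curv G * tnorm G f * gsin G (s * tnorm G f)) *\<^sub>R x"

lemma expmap_zero: "expmap G x 0 = x"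
  by (cases G) (simp_all add: tnorm_zero)

lemma coform_tangent:
  assumes "x \<in> points G" "u \<in> tangent G x"
  shows "coform G u v = curv G * form G u v"
  using assms by (cases "G = Euclidean") (auto simp: form_eq_coform curv_def coform_def split: geometry.splits)

lemma geodesic_derivative:
  "((\<lambda>s. expmap G x (s *\<^sub>R f)) has_vector_derivative geodesic_velocity G x f s) (at s)"
  if x: "x \<in> points G" and f: "f \<in> tangent G x"
proof (cases "f = 0")
  case True
  then show ?thesis by (simp add: expmap_zero geodesic_velocity_def tnorm_zero)
next
  case False
  define n where "n = tnorm G f"
  have n: "n > 0" using tnorm_pos[OF x f False] by (simp add: n_def)
  have c: "((\<lambda>s. gcos G (s * n)) has_real_derivative (- curv G * gsin G (s * n)) * n) (at s)"
    by (rule DERIV_chain2[OF gcos_derivative]) (auto intro!: derivative_eq_intros)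
  have d: "((\<lambda>s. gsin G (s * n) / n) has_real_derivative gcos G (s * n)) (at s)"
    using n by (auto intro!: derivative_eq_intros DERIV_chain2[OF gsin_derivative])
  have "((\<lambda>s. gcos G (s * n) *\<^sub>R x + (gsin G (s * n) / n) *\<^sub>R f) has_vector_derivative
      ((- curv G * gsin G (s * n)) * n) *\<^sub>R x + gcos G (s * n) *\<^sub>R f) (at s)"
    using has_vector_derivative_add[OF has_vector_derivative_scaleR[OF c has_vector_derivative_const[of x]]
        has_vector_derivative_scaleR[OF d has_vector_derivative_const[of f]]] by simp
  then show ?thesis
    using expmap_eq[of G f x] n by (simp add: geodesic_velocity_def n_def algebra_simps)
qed

lemma geodesic_second_derivative:
  "(geodesic_velocity G x f has_vector_derivative - (curv G * (tnorm G f)\<^sup>2) *\<^sub>R expmap G x (s *\<^sub>R f)) (at s)"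
  if x: "x \<in> points G" and f: "f \<in> tangent G x"
proof (cases "f = 0")
  case True
  then show ?thesis by (simp add: geodesic_velocity_def[abs_def] tnorm_zero)
next
  case False
  define n where "n = tnorm G f"
  have n: "n > 0" using tnorm_pos[OF x f False] by (simp add: n_def)
  have c: "((\<lambda>s. gcos G (s * n)) has_real_derivative (- curv G * gsin G (s * n)) * n) (at s)"
    by (rule DERIV_chain2[OF gcos_derivative]) (auto intro!: derivative_eq_intros)
  have d: "((\<lambda>s. curv G * n * gsin G (s * n)) has_real_derivative curv G * n * (gcos G (s * n) * n)) (at s)"
    by (auto intro!: derivative_eq_intros DERIV_chain2[OF gsin_derivative])
  have "(geodesic_velocity G x f has_vector_derivative
      ((- curv G * gsin G (s * n)) * n) *\<^sub>R f - (curv G * n * (gcos G (s * n) * n)) *\<^sub>R x) (at s)"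
    using has_vector_derivative_diff[OF has_vector_derivative_scaleR[OF c has_vector_derivative_const[of f]]
        has_vector_derivative_scaleR[OF d has_vector_derivative_const[of x]]]
    by (simp add: geodesic_velocity_def[abs_def] n_def)
  then show ?thesis
    using expmap_eq[of G f x] n by (simp add: n_def algebra_simps power2_eq_square)
qed

lemma geodesic_velocity_zero: "geodesic_velocity G x f 0 = f"
  by (simp add: geodesic_velocity_def gcos_gsin_zero)

lemma expmap_in_points:
  assumes x: "x \<in> points G" and f: "f \<in> tangent G x"
  shows "expmap G x (s *\<^sub>R f) \<in> points G"
proof (cases "f = 0")
  case True
  then show ?thesis using x by (simp add: expmap_zero)
next
  case False
  define n where "n = tnorm G f"
  define c where "c = gcos G (s * n)"
  define d where "d = gsin G (s * n)"
  have n: "n > 0" using tnorm_pos[OF x f False] by (simp add: n_def)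
  have \<gamma>: "expmap G x (s *\<^sub>R f) = c *\<^sub>R x + (d / n) *\<^sub>R f"
    using expmap_eq n by (simp add: n_def c_def d_def)
  have xx: "coform G x x = 1" "coform G x f = 0" "coform G f x = 0"
    using x f by (simp_all add: points_iff tangent_iff coform_commute)
  have ff: "coform G f f = curv G * n\<^sup>2"
    using coform_tangent[OF x f] tnorm_square[OF x f] by (simp add: n_def)
  have cd: "c\<^sup>2 + curv G * d\<^sup>2 = 1" by (simp add: c_def d_def gcos_gsin)
  have "coform G (c *\<^sub>R x + (d / n) *\<^sub>R f) (c *\<^sub>R x + (d / n) *\<^sub>R f) = c\<^sup>2 + curv G * d\<^sup>2"
    using n by (simp add: coform.add_left coform.add_right coform.scaleR_left coform.scaleR_right
        xx ff power2_eq_square)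
  then have 1: "coform G (expmap G x (s *\<^sub>R f)) (expmap G x (s *\<^sub>R f)) = 1" using cd \<gamma> by simp
  show ?thesis
  proof (cases G)
    case Euclidean
    then show ?thesis using x f by simp
  next
    case Spherical
    then show ?thesis using 1 points_iff by blast
  next
    case True: Hyperbolic
    have "(f $ 0)\<^sup>2 \<le> ((x $ 0)\<^sup>2 - 1) * n\<^sup>2"
      using hyperbolic_tangent_bound[of x f] x f True tnorm_square[OF x f] by (simp add: n_def)
    also have "\<dots> < (x $ 0 * n)\<^sup>2" using n by (simp add: power_mult_distrib algebra_simps)
    finally have "\<bar>f $ 0\<bar> < \<bar>x $ 0 * n\<bar>" by (metis real_sqrt_abs real_sqrt_less_iff)
    moreover have x0: "x $ 0 > 0" using x True by simp
    ultimately have f0: "\<bar>f $ 0\<bar> < x $ 0 * n" using n by (simp add: abs_mult)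
    have "c\<^sup>2 = 1 + d\<^sup>2" using cd True by (simp add: curv_def)
    then have "\<bar>d\<bar> < \<bar>c\<bar>" by (metis real_sqrt_abs real_sqrt_less_iff less_add_same_cancel2 zero_less_one)
    moreover have "c > 0" using True by (simp add: c_def gcos_def)
    ultimately have dc: "\<bar>d\<bar> < c" by simp
    have "\<bar>d\<bar> * \<bar>f $ 0\<bar> < c * (x $ 0 * n)"
      using dc f0 by (intro mult_strict_mono') auto
    then have "c * (x $ 0 * n) + d * f $ 0 > 0"
      using abs_mult[of d "f $ 0"] by linarith
    then have "(c * (x $ 0 * n) + d * f $ 0) / n > 0" using n by (rule divide_pos_pos)
    then have "c * x $ 0 + d / n * f $ 0 > 0" using n by (simp add: field_simps)
    then show ?thesis using 1 \<gamma> by (simp add: points_iff)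
  qed
qed

lemma geodesic_velocity_tangent:
  assumes x: "x \<in> points G" and f: "f \<in> tangent G x"
  shows "geodesic_velocity G x f s \<in> tangent G (expmap G x (s *\<^sub>R f))"
proof -
  have "coform G (expmap G x (s *\<^sub>R f)) (geodesic_velocity G x f s) = 0"
  proof (cases "f = 0")
    case True
    then show ?thesis by (simp add: geodesic_velocity_def tnorm_zero coform.zero_right)
  next
    case False
    have n: "tnorm G f > 0" using tnorm_pos[OF x f False] .
    have xx: "coform G x x = 1" "coform G x f = 0" "coform G f x = 0"
      using x f by (simp_all add: points_iff tangent_iff coform_commute)
    have ff: "coform G f f = curv G * (tnorm G f)\<^sup>2"
      using coform_tangent[OF x f] tnorm_square[OF x f] by simp
    show ?thesis
      using n by (simp add: expmap_eq geodesic_velocity_def coform.add_left coform.diff_right coform.scaleR_left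
          coform.scaleR_right xx ff power2_eq_square)
  qed
  then show ?thesis by (simp add: tangent_iff expmap_in_points[OF assms])
qed

lemma parallel_along_geodesic_velocity:
  assumes x: "x \<in> points G" and f: "f \<in> tangent G x"
  shows "parallel_along G (\<lambda>s. expmap G x (s *\<^sub>R f)) (geodesic_velocity G x f)"
  unfolding parallel_along_def
proof (intro allI conjI geodesic_velocity_tangent[OF assms] exI ballI)
  fix s
  show "(geodesic_velocity G x f has_vector_derivative - (curv G * (tnorm G f)\<^sup>2) *\<^sub>R expmap G x (s *\<^sub>R f)) (at s)"
    by (rule geodesic_second_derivative[OF assms])
  fix u assume "u \<in> tangent G (expmap G x (s *\<^sub>R f))"
  then have "curv G * form G (expmap G x (s *\<^sub>R f)) u = 0"
    by (rule curv_form_tangent[OF expmap_in_points[OF assms]])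
  then show "form G (- (curv G * (tnorm G f)\<^sup>2) *\<^sub>R expmap G x (s *\<^sub>R f)) u = 0"
    by (auto simp: form.scaleR_left form.minus_left)
qed

text \<open>
  The difference of two parallel fields is parallel, hence of constant length for a form that is
  positive definite on tangent spaces, and it vanishes initially.
\<close>

lemma parallel_transport_unique:
  assumes \<gamma>: "\<And>s. \<gamma> s \<in> points G" and X: "parallel_along G \<gamma> X" and Y: "parallel_along G \<gamma> Y"
    and "X 0 = Y 0"
  shows "X = Y"
proof
  fix r
  define Z where "Z s = X s - Y s" for s
  have Zt: "Z s \<in> tangent G (\<gamma> s)" for s
    using X Y subspace_diff[OF subspace_tangent[OF \<gamma>]] by (simp add: parallel_along_def Z_def)
  have "((\<lambda>s. form G (Z s) (Z s)) has_real_derivative 0) (at s)" for s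
  proof -
    obtain X' Y' where d: "(X has_vector_derivative X') (at s)" "(Y has_vector_derivative Y') (at s)"
      and o: "\<forall>u\<in>tangent G (\<gamma> s). form G X' u = 0" "\<forall>u\<in>tangent G (\<gamma> s). form G Y' u = 0"
      using X Y unfolding parallel_along_def by metis
    have "(Z has_vector_derivative X' - Y') (at s)"
      unfolding Z_def by (intro has_vector_derivative_diff d)
    from form.has_vector_derivative[OF this this, of G] show ?thesis
      using o Zt[of s] by (simp add: has_real_derivative_iff_has_vector_derivative
          form_commute[of G "Z s" "X' - Y'"] form.diff_left)
  qed
  then have "form G (Z r) (Z r) = form G (Z 0) (Z 0)" by (intro DERIV_isconst_all) auto
  also have "\<dots> = 0" using assms(4) by (simp add: Z_def form.zero_right)
  finally have "Z r = 0" using form_pos[OF \<gamma> Zt] by force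
  then show "X r = Y r" by (simp add: Z_def)
qed

text \<open>
  A force is transported along the geodesic that it generates. There the velocity field is parallel,
  so by uniqueness it is the transport.
\<close>

lemma transport_eq_geodesic_velocity:
  assumes x: "x \<in> points G" and f: "f \<in> tangent G x"
    and X: "parallel_along G (\<lambda>s. expmap G x (s *\<^sub>R f)) X" "X 0 = f"
  shows "X = geodesic_velocity G x f"
  by (rule parallel_transport_unique[OF expmap_in_points[OF x f] X(1) parallel_along_geodesic_velocity[OF x f]])
    (simp add: X(2) geodesic_velocity_zero)

section \<open>Killing fields\<close>

lemma killing_field_has_derivative:
  assumes "killing_field G K" "x \<in> points G"
  shows "(K has_derivative frechet_derivative K (at x)) (at x)"
proof -
  obtain U where "points G \<subseteq> U" "smooth_on U K"
    using assms(1) unfolding killing_field_def by blast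
  then have "x \<in> U" "Ck_on (Suc 0) U K" using assms(2) unfolding smooth_on_def by blast+
  then obtain f' where "(K has_derivative f') (at x)" by auto
  then show ?thesis using differentiableI frechet_derivative_works by blast
qed

text \<open>
  The conserved quantity of Clairaut: the product of the velocity of a geodesic with a Killing
  field is constant. Its derivative has two terms; the acceleration is normal, and the other one
  vanishes by the Killing equation.
\<close>

lemma killing_field_geodesic:
  assumes K: "killing_field G K" and x: "x \<in> points G" and f: "f \<in> tangent G x"
  shows "form G (geodesic_velocity G x f s) (K (expmap G x (s *\<^sub>R f))) = form G f (K x)"
proof -
  let ?\<gamma> = "\<lambda>s. expmap G x (s *\<^sub>R f)"
  have "((\<lambda>s. form G (geodesic_velocity G x f s) (K (?\<gamma> s))) has_real_derivative 0) (at s)" for s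
  proof -
    note pt = expmap_in_points[OF x f, of s]
    note tan = geodesic_velocity_tangent[OF x f, of s]
    let ?D = "frechet_derivative K (at (?\<gamma> s))"
    have "(K has_derivative ?D) (at (?\<gamma> s) within range ?\<gamma>)"
      by (rule has_derivative_at_withinI[OF killing_field_has_derivative[OF K pt]])
    then have dK: "((\<lambda>s. K (?\<gamma> s)) has_vector_derivative ?D (geodesic_velocity G x f s)) (at s)"
      using vector_derivative_diff_chain_within[OF geodesic_derivative[OF x f, of s]]
      by (simp add: o_def)
    have "form G (?D (geodesic_velocity G x f s)) (geodesic_velocity G x f s) + form G (geodesic_velocity G x f s) (?D (geodesic_velocity G x f s)) = 0"
      using K pt tan unfolding killing_field_def by blast
    then have 1: "form G (geodesic_velocity G x f s) (?D (geodesic_velocity G x f s)) = 0"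
      by (simp add: form_commute)
    have "K (?\<gamma> s) \<in> tangent G (?\<gamma> s)" using K pt unfolding killing_field_def by blast
    then have 2: "curv G * form G (?\<gamma> s) (K (?\<gamma> s)) = 0" by (rule curv_form_tangent[OF pt])
    show ?thesis
      using form.has_vector_derivative[OF geodesic_second_derivative[OF x f] dK, of G] 1 2
      by (auto simp: has_real_derivative_iff_has_vector_derivative form.scaleR_left form.minus_left)
  qed
  then have "form G (geodesic_velocity G x f s) (K (?\<gamma> s)) = form G (geodesic_velocity G x f 0) (K (?\<gamma> 0))"
    by (intro DERIV_isconst_all) auto
  then show ?thesis by (simp add: geodesic_velocity_zero expmap_zero)
qed

text \<open>
  Sums and multiples of Killing fields have to be smooth, so that the trivial deformations form a
  subspace; the rotation fields used below are linear.
\<close>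

lemma Ck_on_add: "Ck_on k U f \<Longrightarrow> Ck_on k U g \<Longrightarrow> Ck_on k U (\<lambda>x. f x + g x)"
proof (induction k arbitrary: f g)
  case 0
  then show ?case by (simp add: continuous_on_add)
next
  case (Suc k)
  obtain f' g' where "\<forall>x\<in>U. (f has_derivative f' x) (at x)" "\<forall>v. Ck_on k U (\<lambda>x. f' x v)"
    "\<forall>x\<in>U. (g has_derivative g' x) (at x)" "\<forall>v. Ck_on k U (\<lambda>x. g' x v)"
    using Suc.prems by auto
  then show ?case
    using Suc.IH by (auto intro!: exI[of _ "\<lambda>x v. f' x v + g' x v"] has_derivative_add)
qed

lemma Ck_on_scaleR: "Ck_on k U f \<Longrightarrow> Ck_on k U (\<lambda>x. c *\<^sub>R f x)"
proof (induction k arbitrary: f)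
  case 0
  then show ?case by (simp add: continuous_on_scaleR)
next
  case (Suc k)
  obtain f' where "\<forall>x\<in>U. (f has_derivative f' x) (at x)" "\<forall>v. Ck_on k U (\<lambda>x. f' x v)"
    using Suc.prems by auto
  then show ?case
    using Suc.IH by (auto intro!: exI[of _ "\<lambda>x v. c *\<^sub>R f' x v"] has_derivative_scaleR_right)
qed

lemma Ck_on_subset: "Ck_on k U f \<Longrightarrow> V \<subseteq> U \<Longrightarrow> Ck_on k V f"
proof (induction k arbitrary: f)
  case 0
  then show ?case using continuous_on_subset by auto
next
  case (Suc k)
  then show ?case by (simp add: subset_iff) metis
qed

lemma Ck_on_const: "Ck_on k U (\<lambda>x. c)"
proof (induction k arbitrary: c)
  case (Suc k)
  then show ?case by (auto intro!: exI[of _ "\<lambda>x v. 0"])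
qed auto

lemma smooth_on_bounded_linear: "smooth_on U f" if "bounded_linear f"
  unfolding smooth_on_def
proof
  fix k
  show "Ck_on k U f"
  proof (cases k)
    case 0
    then show ?thesis using that by (simp add: linear_continuous_on)
  next
    case (Suc m)
    then show ?thesis using that
      by (auto intro!: exI[of _ "\<lambda>x. f"] Ck_on_const bounded_linear_imp_has_derivative)
  qed
qed

lemma killing_field_zero: "killing_field G (\<lambda>x. 0)"
proof -
  have "\<exists>U. open U \<and> points G \<subseteq> U \<and> smooth_on U (\<lambda>x::'a rvec. 0::'a rvec)"
    by (intro exI[of _ UNIV]) (simp add: smooth_on_def Ck_on_const)
  then show ?thesis
    using subspace_0[OF subspace_tangent]
    by (auto simp: killing_field_def form.zero_left form.zero_right)
qed

lemma killing_field_scaleR: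
  assumes K: "killing_field G K"
  shows "killing_field G (\<lambda>x. c *\<^sub>R K x)"
proof -
  have d: "frechet_derivative (\<lambda>x. c *\<^sub>R K x) (at x) = (\<lambda>v. c *\<^sub>R frechet_derivative K (at x) v)"
    if "x \<in> points G" for x
    by (rule frechet_derivative_at[symmetric])
      (intro has_derivative_scaleR_right killing_field_has_derivative[OF K that])
  obtain U where "open U" "points G \<subseteq> U" "smooth_on U K"
    using K unfolding killing_field_def by blast
  then have "\<exists>U. open U \<and> points G \<subseteq> U \<and> smooth_on U (\<lambda>x. c *\<^sub>R K x)"
    by (auto simp: smooth_on_def intro!: Ck_on_scaleR exI[of _ U])
  moreover have "\<forall>x\<in>points G. c *\<^sub>R K x \<in> tangent G x"
    using K subspace_scale[OF subspace_tangent] unfolding killing_field_def by blast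
  ultimately show ?thesis
    using K by (simp add: killing_field_def d form.scaleR_left form.scaleR_right flip: distrib_left)
qed

lemma killing_field_add:
  assumes K: "killing_field G K" and L: "killing_field G L"
  shows "killing_field G (\<lambda>x. K x + L x)"
proof -
  have d: "frechet_derivative (\<lambda>x. K x + L x) (at x)
      = (\<lambda>v. frechet_derivative K (at x) v + frechet_derivative L (at x) v)"
    if "x \<in> points G" for x
    by (rule frechet_derivative_at[symmetric])
      (intro has_derivative_add killing_field_has_derivative[OF K that] killing_field_has_derivative[OF L that])
  obtain U V where U: "open U" "points G \<subseteq> U" "smooth_on U K" and V: "open V" "points G \<subseteq> V" "smooth_on V L"
    using K L unfolding killing_field_def by blast
  have "smooth_on (U \<inter> V) (\<lambda>x. K x + L x)"
    using U(3) V(3) by (auto simp: smooth_on_def intro!: Ck_on_add intro: Ck_on_subset)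
  then have "\<exists>U. open U \<and> points G \<subseteq> U \<and> smooth_on U (\<lambda>x. K x + L x)"
    using U V by (intro exI[of _ "U \<inter> V"]) auto
  moreover have "\<forall>x\<in>points G. K x + L x \<in> tangent G x"
    using K L subspace_add[OF subspace_tangent] unfolding killing_field_def by blast
  moreover have "form G (frechet_derivative (\<lambda>x. K x + L x) (at x) u) v
      + form G u (frechet_derivative (\<lambda>x. K x + L x) (at x) v) = 0"
    if "x \<in> points G" "u \<in> tangent G x" "v \<in> tangent G x" for x u v
  proof -
    have "form G (frechet_derivative K (at x) u) v + form G u (frechet_derivative K (at x) v) = 0"
      "form G (frechet_derivative L (at x) u) v + form G u (frechet_derivative L (at x) v) = 0"
      using K L that unfolding killing_field_def by blast+
    then show ?thesis by (simp add: d[OF that(1)] form.add_left form.add_right)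
  qed
  ultimately show ?thesis by (simp add: killing_field_def)
qed

section \<open>Rotation fields\<close>

text \<open>
  Represents the functional \<open>n \<bullet> f\<close> of tangent vectors \<open>f\<close> with respect to the metric. In Euclidean
  space the \<open>0\<close>-th coordinate is removed, which makes the result a tangent vector.
\<close>

definition form_dual :: "geometry \<Rightarrow> 'n::{finite,zero} rvec \<Rightarrow> 'n rvec" where
  "form_dual G n = n + axis 0 ((curv G - 1) * n $ 0)"

lemma form_dual_tangent:
  assumes "x \<in> points G" "f \<in> tangent G x"
  shows "form G f (form_dual G n) = n \<bullet> f"
proof -
  have "f $ 0 = 0" if "G = Euclidean" using assms that by simp
  then show ?thesis
    by (cases G) (auto simp: form_eq_inner form_dual_def curv_def inner_add_right inner_axis axis_nth
        inner_commute algebra_simps)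
qed

lemma coform_dual: "coform G x (form_dual G n) = curv G * (n \<bullet> x)"
  by (cases G) (auto simp: coform_def form_dual_def curv_def inner_add_right inner_axis axis_nth
      inner_commute algebra_simps)

text \<open>
  The linear Killing fields \<open>x \<mapsto> A x\<close>, where \<open>A\<close> is the skew map of the bivector \<open>m \<and> n\<close>. In
  Euclidean space they include the translations. Pairing a force \<open>(x, f)\<close> with this field gives the
  coordinate \<open>(m \<bullet> x) (n \<bullet> f) - (n \<bullet> x) (m \<bullet> f)\<close> of the bivector \<open>x \<and> f\<close>.
\<close>

lemma killing_field_rotation:
  "killing_field G (\<lambda>x. (m \<bullet> x) *\<^sub>R form_dual G n - (n \<bullet> x) *\<^sub>R form_dual G m)" (is "killing_field G ?K")
proof -
  have lin: "bounded_linear ?K"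
    by (intro bounded_linear_intros bounded_linear_sub bounded_linear_scaleR_const bounded_linear_inner_right)
  have d: "frechet_derivative ?K (at x) = ?K" for x
    by (rule frechet_derivative_at[symmetric]) (rule bounded_linear_imp_has_derivative[OF lin])
  have "\<exists>U. open U \<and> points G \<subseteq> U \<and> smooth_on U ?K"
    by (intro exI[of _ UNIV]) (simp add: smooth_on_bounded_linear[OF lin])
  moreover have "\<forall>x\<in>points G. ?K x \<in> tangent G x"
    by (simp add: tangent_iff coform.diff_right coform.scaleR_right coform_dual)
  moreover have "form G (?K u) v + form G u (?K v) = 0"
    if "x \<in> points G" "u \<in> tangent G x" "v \<in> tangent G x" for x u v
    using form_dual_tangent[OF that(1,2)] form_dual_tangent[OF that(1,3)]
    by (simp add: form.diff_left form.diff_right form.scaleR_left form.scaleR_right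
        form_commute[of G "form_dual G _"])
  ultimately show ?thesis unfolding killing_field_def d by blast
qed

section \<open>Infinitesimal isometric deformations\<close>

text \<open>
  The first variation of length: only the components of the velocities along the connecting geodesic
  count. The denominator is positive because the points are neither equal nor antipodal.
\<close>

lemma rdist_has_derivative:
  assumes x: "P 0 \<in> points G" and y: "Q 0 \<in> points G"
    and ne: "P 0 \<noteq> Q 0" "G = Spherical \<longrightarrow> P 0 \<noteq> - Q 0"
    and P: "(P has_vector_derivative u) (at 0)" "u \<in> tangent G (P 0)"
    and Q: "(Q has_vector_derivative v) (at 0)" "v \<in> tangent G (Q 0)"
  shows "((\<lambda>t. rdist G (P t) (Q t)) has_real_derivative
    - (form G u (proj G (P 0) (Q 0)) + form G v (proj G (Q 0) (P 0))) / tnorm G (proj G (P 0) (Q 0))) (at 0)"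
proof (cases G)
  case Euclidean
  let ?R = "\<lambda>t. P t - Q t"
  have R: "(?R has_vector_derivative u - v) (at 0)" by (intro has_vector_derivative_diff P Q)
  have "((\<lambda>t. ?R t \<bullet> ?R t) has_vector_derivative ?R 0 \<bullet> (u - v) + (u - v) \<bullet> ?R 0) (at 0)"
    by (rule bounded_bilinear.has_vector_derivative[OF bounded_bilinear_inner R R])
  then have "((\<lambda>t. ?R t \<bullet> ?R t) has_real_derivative 2 * (?R 0 \<bullet> (u - v))) (at 0)"
    by (simp add: has_real_derivative_iff_has_vector_derivative inner_commute)
  moreover have "?R 0 \<bullet> ?R 0 > 0" using ne by simp
  ultimately have "((\<lambda>t. sqrt (?R t \<bullet> ?R t)) has_real_derivative
      inverse (sqrt (?R 0 \<bullet> ?R 0)) / 2 * (2 * (?R 0 \<bullet> (u - v)))) (at 0)"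
    by (intro DERIV_chain2[of sqrt] DERIV_real_sqrt)
  then have "((\<lambda>t. sqrt (?R t \<bullet> ?R t)) has_real_derivative
      (?R 0 \<bullet> (u - v)) / sqrt (?R 0 \<bullet> ?R 0)) (at 0)"
    by (rule DERIV_cong) (simp add: field_simps)
  moreover have "coform G (P 0) (Q 0) = 1" "coform G (Q 0) (P 0) = 1"
    using Euclidean x y by (simp_all add: coform_def curv_def)
  ultimately show ?thesis using Euclidean
    by (simp add: dist_norm norm_eq_sqrt_inner proj_def tnorm_def form_eq_inner
        inner_diff_left inner_diff_right inner_commute algebra_simps)
next
  case Spherical
  let ?c = "coform G (P 0) (Q 0)"
  have c: "\<bar>?c\<bar> < 1" and n: "tnorm G (proj G (P 0) (Q 0)) = sqrt (1 - ?c\<^sup>2)"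
    using coform_spherical_bound[of "P 0" "Q 0"] x y ne Spherical by auto
  have d: "((\<lambda>t. form G (P t) (Q t)) has_real_derivative form G (P 0) v + form G u (Q 0)) (at 0)"
    using form.has_vector_derivative[OF P(1) Q(1), of G]
    by (simp add: has_real_derivative_iff_has_vector_derivative)
  have fc: "form G (P 0) (Q 0) = ?c" using Spherical by (simp add: form_eq_coform curv_def)
  have D: "((\<lambda>t. arccos (form G (P t) (Q t))) has_real_derivative
      inverse (- sqrt (1 - ?c\<^sup>2)) * (form G (P 0) v + form G u (Q 0))) (at 0)"
    using c DERIV_chain2[OF DERIV_arccos d] by (simp only: fc abs_less_iff) auto
  have e: "form G (P 0) v + form G u (Q 0) = form G u (proj G (P 0) (Q 0)) + form G v (proj G (Q 0) (P 0))"
    using Spherical form_proj[OF _ x P(2)] form_proj[OF _ y Q(2)] by (simp add: form_commute[of _ "P 0" v])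
  have "((\<lambda>t. arccos (form G (P t) (Q t))) has_real_derivative
    - (form G u (proj G (P 0) (Q 0)) + form G v (proj G (Q 0) (P 0))) / tnorm G (proj G (P 0) (Q 0))) (at 0)"
    by (rule DERIV_cong[OF D]) (simp only: n e, simp add: divide_inverse algebra_simps)
  then show ?thesis using Spherical by simp
next
  case Hyperbolic
  let ?c = "coform G (P 0) (Q 0)"
  have c: "?c > 1" and n: "tnorm G (proj G (P 0) (Q 0)) = sqrt (?c\<^sup>2 - 1)"
    using coform_hyperbolic_bound[of "P 0" "Q 0"] x y ne Hyperbolic by auto
  have d: "((\<lambda>t. - form G (P t) (Q t)) has_real_derivative - (form G (P 0) v + form G u (Q 0))) (at 0)"
    using form.has_vector_derivative[OF P(1) Q(1), of G]
    by (intro DERIV_minus) (simp add: has_real_derivative_iff_has_vector_derivative)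
  have fc: "- form G (P 0) (Q 0) = ?c" using Hyperbolic by (simp add: form_eq_coform curv_def)
  have D: "((\<lambda>t. arcosh (- form G (P t) (Q t))) has_real_derivative
      (1 / sqrt (?c\<^sup>2 - 1)) * (- (form G (P 0) v + form G u (Q 0)))) (at 0)"
    using c DERIV_chain2[OF arcosh_real_has_field_derivative d] by (simp only: fc)
  have e: "form G (P 0) v + form G u (Q 0) = form G u (proj G (P 0) (Q 0)) + form G v (proj G (Q 0) (P 0))"
    using Hyperbolic form_proj[OF _ x P(2)] form_proj[OF _ y Q(2)] by (simp add: form_commute[of _ "P 0" v])
  have "((\<lambda>t. arcosh (- form G (P t) (Q t))) has_real_derivative
    - (form G u (proj G (P 0) (Q 0)) + form G v (proj G (Q 0) (P 0))) / tnorm G (proj G (P 0) (Q 0))) (at 0)"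
    by (rule DERIV_cong[OF D]) (simp only: n e, simp add: divide_inverse algebra_simps)
  then show ?thesis using Hyperbolic by simp
qed

text \<open>
  Differentiation maps the span of a geodesic and its velocity into itself, so all derivatives
  have the same shape. This is what makes the induction on \<open>k\<close> go through.
\<close>

lemma Ck_on_geodesic:
  assumes x: "x \<in> points G" and f: "f \<in> tangent G x"
  shows "Ck_on k U (\<lambda>t. a *\<^sub>R expmap G x (t *\<^sub>R f) + b *\<^sub>R geodesic_velocity G x f t)"
proof (induction k arbitrary: a b)
  case 0
  have "isCont (\<lambda>t. a *\<^sub>R expmap G x (t *\<^sub>R f) + b *\<^sub>R geodesic_velocity G x f t) t" for t
    using geodesic_derivative[OF assms] geodesic_second_derivative[OF assms]
    by (intro continuous_intros) (auto intro: has_vector_derivative_continuous)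
  then show ?case by (simp add: continuous_at_imp_continuous_on)
next
  case (Suc k)
  let ?m = "curv G * (tnorm G f)\<^sup>2"
  let ?d = "\<lambda>t. a *\<^sub>R geodesic_velocity G x f t + b *\<^sub>R (- ?m *\<^sub>R expmap G x (t *\<^sub>R f))"
  have d: "((\<lambda>t. a *\<^sub>R expmap G x (t *\<^sub>R f) + b *\<^sub>R geodesic_velocity G x f t) has_vector_derivative ?d t) (at t)" for t
    by (intro has_vector_derivative_add bounded_linear.has_vector_derivative[OF bounded_linear_scaleR_right]
        geodesic_derivative[OF assms] geodesic_second_derivative[OF assms])
  have eq: "(\<lambda>t. v *\<^sub>R ?d t) = (\<lambda>t. (- v * b * ?m) *\<^sub>R expmap G x (t *\<^sub>R f) + (v * a) *\<^sub>R geodesic_velocity G x f t)" for v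
    by (simp add: algebra_simps)
  then have "Ck_on k U (\<lambda>t. v *\<^sub>R ?d t)" for v by (simp only: eq Suc.IH)
  then show ?case
    using d by (auto simp: has_vector_derivative_def intro!: exI[of _ "\<lambda>t v. v *\<^sub>R ?d t"])
qed

lemma smooth_on_geodesic:
  assumes x: "x \<in> points G" and f: "f \<in> tangent G x"
  shows "smooth_on U (\<lambda>t. expmap G x (t *\<^sub>R f))"
  using Ck_on_geodesic[OF assms, of _ U 1 0] by (simp add: smooth_on_def)

text \<open>
  Being a framework is an open condition on the positions of the finitely many vertices.
\<close>

lemma framework_geodesics:
  assumes fw: "framework G E p" and q: "\<And>i. q i \<in> tangent G (p i)"
  shows "\<exists>\<epsilon>>0. \<forall>t\<in>{-\<epsilon><..<\<epsilon>}. framework G E (\<lambda>i. expmap G (p i) (t *\<^sub>R q i))"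
proof -
  let ?P = "\<lambda>i t. expmap G (p i) (t *\<^sub>R q i)"
  have pt: "p i \<in> points G" for i using fw by (simp add: framework_def)
  have lim: "(?P i \<longlongrightarrow> p i) (at 0)" for i
    using has_vector_derivative_continuous[OF geodesic_derivative[OF pt q, of i 0]]
    by (simp add: continuous_at expmap_zero)
  have "\<forall>\<^sub>F t in at 0. ?P i t \<noteq> ?P j t \<and> (G = Spherical \<longrightarrow> ?P i t \<noteq> - ?P j t)"
    if "{i, j} \<in> E" for i j
  proof -
    have ne: "p i \<noteq> p j" "G = Spherical \<longrightarrow> p i \<noteq> - p j" using fw that by (auto simp: framework_def)
    have "\<forall>\<^sub>F t in at 0. ?P i t - ?P j t \<noteq> 0"
      using ne by (intro tendsto_imp_eventually_ne[OF tendsto_diff[OF lim lim]]) simp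
    moreover have "\<forall>\<^sub>F t in at 0. G = Spherical \<longrightarrow> ?P i t + ?P j t \<noteq> 0"
    proof (cases "G = Spherical")
      case True
      then have "p i + p j \<noteq> 0" using ne by (simp add: eq_neg_iff_add_eq_0)
      then show ?thesis
        using tendsto_imp_eventually_ne[OF tendsto_add[OF lim lim]] by (auto elim: eventually_mono)
    qed simp
    ultimately show ?thesis
      by eventually_elim (auto simp: eq_neg_iff_add_eq_0)
  qed
  then have "\<forall>\<^sub>F t in at 0. \<forall>i j. {i, j} \<in> E \<longrightarrow> ?P i t \<noteq> ?P j t \<and> (G = Spherical \<longrightarrow> ?P i t \<noteq> - ?P j t)"
    by (intro eventually_all_finite) (simp add: eventually_all_finite eventually_conj_iff)
  then have "\<forall>\<^sub>F t in at 0. framework G E (\<lambda>i. ?P i t)"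
    using fw expmap_in_points[OF pt q] by (auto simp: framework_def elim!: eventually_mono)
  then obtain \<epsilon> where "\<epsilon> > 0" and \<epsilon>: "\<And>t. t \<noteq> 0 \<Longrightarrow> dist t 0 < \<epsilon> \<Longrightarrow> framework G E (\<lambda>i. ?P i t)"
    unfolding eventually_at by auto
  have "framework G E (\<lambda>i. ?P i t)" if "t \<in> {-\<epsilon><..<\<epsilon>}" for t
    using \<epsilon>[of t] that fw by (cases "t = 0") (auto simp: expmap_zero dist_norm abs_less_iff)
  then show ?thesis using \<open>\<epsilon> > 0\<close> by blast
qed

text \<open>
  The existence of a deforming family is a linear condition on the velocities: the first variation
  formula gives it for every family, and moving each vertex along its geodesic provides a family.
\<close>

lemma isometric_deformations_iff:
  assumes fw: "framework G E p"
  shows "q \<in> isometric_deformations G E p \<longleftrightarrow> q \<in> tangent_fields G p \<and>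
    (\<forall>i j. {i, j} \<in> E \<longrightarrow> form G (q $ i) (proj G (p i) (p j)) + form G (q $ j) (proj G (p j) (p i)) = 0)"
    (is "_ \<longleftrightarrow> _ \<and> ?inf")
proof -
  have pt: "p i \<in> points G" for i using fw by (simp add: framework_def)
  have ne: "p i \<noteq> p j" "G = Spherical \<longrightarrow> p i \<noteq> - p j" if "{i, j} \<in> E" for i j
    using fw that by (auto simp: framework_def)
  have deriv: "((\<lambda>t. rdist G (P i t) (P j t)) has_real_derivative
      - (form G (q $ i) (proj G (p i) (p j)) + form G (q $ j) (proj G (p j) (p i)))
        / tnorm G (proj G (p i) (p j))) (at 0)"
    if "{i, j} \<in> E" "q \<in> tangent_fields G p" "\<And>i. P i 0 = p i \<and> (P i has_vector_derivative q $ i) (at 0)"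
    for P i j
    using rdist_has_derivative[of "P i" G "P j" "q $ i" "q $ j"] that pt ne[OF that(1)]
    by (simp add: tangent_fields_def)
  show ?thesis
  proof
    assume "q \<in> isometric_deformations G E p"
    then obtain P where qT: "q \<in> tangent_fields G p"
      and P: "\<And>i. P i 0 = p i \<and> (P i has_vector_derivative q $ i) (at 0)"
      and iso: "\<And>i j. {i, j} \<in> E \<Longrightarrow> ((\<lambda>t. rdist G (P i t) (P j t)) has_real_derivative 0) (at 0)"
      unfolding isometric_deformations_def by blast
    have "form G (q $ i) (proj G (p i) (p j)) + form G (q $ j) (proj G (p j) (p i)) = 0"
      if "{i, j} \<in> E" for i j
    proof -
      have "tnorm G (proj G (p i) (p j)) > 0" by (rule rdist_properties(4)[OF pt pt ne[OF that]])
      then show ?thesis using DERIV_unique[OF deriv[OF that qT P] iso[OF that]] by auto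
    qed
    then show "q \<in> tangent_fields G p \<and> ?inf" using qT by blast
  next
    assume q: "q \<in> tangent_fields G p \<and> ?inf"
    then have qT: "\<And>i. q $ i \<in> tangent G (p i)" by (simp add: tangent_fields_def)
    let ?P = "\<lambda>i t. expmap G (p i) (t *\<^sub>R q $ i)"
    obtain \<epsilon> where \<epsilon>: "\<epsilon> > 0" "\<forall>t\<in>{-\<epsilon><..<\<epsilon>}. framework G E (\<lambda>i. ?P i t)"
      using framework_geodesics[OF fw, of "\<lambda>i. q $ i"] qT by blast
    have P: "?P i 0 = p i \<and> (?P i has_vector_derivative q $ i) (at 0)" for i
      using geodesic_derivative[OF pt qT, of i 0] by (simp add: geodesic_velocity_zero expmap_zero)
    have iso: "((\<lambda>t. rdist G (?P i t) (?P j t)) has_real_derivative 0) (at 0)" if "{i, j} \<in> E" for i j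
      using deriv[of i j ?P] q that P by auto
    then show "q \<in> isometric_deformations G E p"
      unfolding isometric_deformations_def
    proof (intro CollectI conjI exI)
      show "q \<in> tangent_fields G p" using q by blast
      show "\<epsilon> > 0" by (rule \<epsilon>(1))
      show "\<forall>i. smooth_on {-\<epsilon><..<\<epsilon>} (?P i)" by (intro allI smooth_on_geodesic pt qT)
      show "\<forall>t\<in>{-\<epsilon><..<\<epsilon>}. framework G E (\<lambda>i. ?P i t)" by (rule \<epsilon>(2))
      show "\<forall>i. ?P i 0 = p i \<and> (?P i has_vector_derivative q $ i) (at 0)" by (intro allI P)
      show "\<forall>i j. {i, j} \<in> E \<longrightarrow>
          ((\<lambda>t. rdist G (?P i t) (?P j t)) has_real_derivative 0) (at 0)"
        by (intro allI impI iso)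
    qed
  qed
qed

section \<open>Equivalence of systems of forces\<close>

text \<open>
  Stands for the bivector \<open>x \<and> v\<close>: neither the force nor the bivector changes if a multiple of \<open>x\<close> is
  added to \<open>v\<close>. Allowing arbitrary ambient vectors \<open>v\<close> makes it possible to expand them in a fixed basis.
\<close>

definition point_force :: "geometry \<Rightarrow> 'n::{finite,zero} rvec \<Rightarrow> 'n rvec \<Rightarrow> 'n force_sum" where
  "point_force G x v = Poly_Mapping.single (x, proj G x v) 1"

lemma force_equiv_zero: "force_equiv G 0 0"
  by (rule force_equiv.refl) simp

lemma force_equiv_sum:
  assumes "\<And>i. i \<in> I \<Longrightarrow> force_equiv G (a i) (b i)"
  shows "force_equiv G (\<Sum>i\<in>I. a i) (\<Sum>i\<in>I. b i)"
  using assms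
  by (induction I rule: infinite_finite_induct) (auto intro: force_equiv_zero force_equiv.add)

lemma point_force_add:
  assumes "x \<in> points G"
  shows "force_equiv G (point_force G x u + point_force G x v) (point_force G x (u + v))"
  using force_equiv.combine[of x "proj G x u" G "proj G x v" 1 1] assms
  by (simp add: point_force_def forces_def proj_tangent proj_add)

lemma point_force_zero: "x \<in> points G \<Longrightarrow> force_equiv G (point_force G x 0) 0"
  using force_equiv.null by (simp add: point_force_def proj_zero)

lemma point_force_sum:
  assumes x: "x \<in> points G" and "finite I"
  shows "force_equiv G (\<Sum>i\<in>I. point_force G x (v i)) (point_force G x (\<Sum>i\<in>I. v i))"
  using assms(2)
proof (induction I rule: finite_induct)
  case empty
  then show ?case using force_equiv.sym[OF point_force_zero[OF x]] by simp
next
  case (insert i I)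
  have "force_equiv G (point_force G x (v i)) (point_force G x (v i))"
    by (rule force_equiv.refl) (simp add: point_force_def forces_def x proj_tangent)
  from force_equiv.trans[OF force_equiv.add[OF this insert.IH] point_force_add[OF x]]
  show ?case using insert.hyps by simp
qed

text \<open>
  The identity \<open>x \<and> y = - y \<and> x\<close> of bivectors, realised by sliding a force along the geodesic
  from \<open>x\<close> to \<open>y\<close>. For \<open>c > 0\<close> the force points towards \<open>y\<close>, which is reached at a parameter \<open>r > 0\<close>, and the
  transported force is the velocity there. Exchanging \<open>x\<close> and \<open>y\<close> settles the case \<open>c < 0\<close>, and for
  equal or antipodal points both forces are zero.
\<close>

lemma point_force_slide:
  assumes x: "x \<in> points G" and y: "y \<in> points G"
  shows "force_equiv G (point_force G x (c *\<^sub>R y)) (point_force G y (- c *\<^sub>R x))"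
proof -
  have slide: "force_equiv G (point_force G x (c *\<^sub>R y)) (point_force G y (- c *\<^sub>R x))"
    if x: "x \<in> points G" and y: "y \<in> points G" and c: "c > 0"
      and ne: "x \<noteq> y" "G = Spherical \<longrightarrow> x \<noteq> - y" for x y :: "'a rvec" and c
  proof -
    define C where "C = coform G x y"
    define S where "S = tnorm G (proj G x y)"
    define f where "f = c *\<^sub>R proj G x y"
    \<comment> \<open>The geodesic generated by the force at \<open>x\<close> has speed \<open>tnorm G f\<close>, so it reaches \<open>y\<close> at this parameter.\<close>
    define r where "r = rdist G x y / tnorm G f"
    note d = rdist_properties[OF x y ne]
    have S: "S > 0" using d(4) by (simp add: S_def)
    have CS: "gcos G (rdist G x y) = C" "gsin G (rdist G x y) = S" using d by (simp_all add: C_def S_def)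
    have one: "C\<^sup>2 + curv G * S\<^sup>2 = 1" using gcos_gsin[of G "rdist G x y"] CS by simp
    have n: "tnorm G f = c * S" using c by (simp add: f_def tnorm_scaleR S_def)
    have rn: "r * tnorm G f = rdist G x y" using n c S by (simp add: r_def)
    have fT: "f \<in> tangent G x"
      unfolding f_def by (intro subspace_scale[OF subspace_tangent[OF x]] proj_tangent[OF x])
    have proj_xy: "proj G x y = y - C *\<^sub>R x" by (simp add: proj_def C_def)
    have "tnorm G f > 0" using n c S by simp
    then have "expmap G x (r *\<^sub>R f) = C *\<^sub>R x + (S / (c * S)) *\<^sub>R f"
      using expmap_eq[of G f x r, unfolded rn CS, unfolded n] n by simp
    also have "\<dots> = y" using c S by (simp add: f_def proj_xy)
    finally have end_point: "expmap G x (r *\<^sub>R f) = y" .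
    have "geodesic_velocity G x f r = (c * C) *\<^sub>R (y - C *\<^sub>R x) - (c * (curv G * S\<^sup>2)) *\<^sub>R x"
      unfolding geodesic_velocity_def rn CS unfolding n by (simp add: f_def proj_xy power2_eq_square algebra_simps)
    also have "curv G * S\<^sup>2 = 1 - C\<^sup>2" using one by simp
    also have "(c * C) *\<^sub>R (y - C *\<^sub>R x) - (c * (1 - C\<^sup>2)) *\<^sub>R x = proj G y (- c *\<^sub>R x)"
      by (simp add: proj_def coform.scaleR_right coform.minus_right coform_commute[of G y x] C_def[symmetric] algebra_simps
          power2_eq_square)
    finally have end_velocity: "geodesic_velocity G x f r = proj G y (- c *\<^sub>R x)" .
    have "force_equiv G (Poly_Mapping.single (x, f) 1)
        (Poly_Mapping.single (expmap G x (r *\<^sub>R f), geodesic_velocity G x f r) 1)"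
      by (rule force_equiv.transport[OF _ parallel_along_geodesic_velocity[OF x fT] geodesic_velocity_zero])
        (simp add: forces_def x fT)
    then show ?thesis
      by (simp only: end_point end_velocity) (simp add: point_force_def f_def proj_scaleR)
  qed
  show ?thesis
  proof (cases "x = y \<or> (G = Spherical \<and> x = - y) \<or> c = 0")
    case True
    then have "proj G x y = 0 \<or> c = 0" "proj G y x = 0 \<or> c = 0"
      unfolding proj_eq_0_iff[OF x y] proj_eq_0_iff[OF y x] by (blast, force)
    then have "proj G x (c *\<^sub>R y) = 0" "proj G y (- c *\<^sub>R x) = 0"
      unfolding proj_scaleR by auto
    then have "force_equiv G (point_force G x (c *\<^sub>R y)) 0" "force_equiv G (point_force G y (- c *\<^sub>R x)) 0"
      using force_equiv.null x y by (simp_all add: point_force_def)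
    then show ?thesis by (blast intro: force_equiv.sym force_equiv.trans)
  next
    case False
    show ?thesis
    proof (cases "c > 0")
      case True
      then show ?thesis using slide[OF x y] False by blast
    next
      case neg: False
      have "y \<noteq> x" "G = Spherical \<longrightarrow> y \<noteq> - x" using False by auto
      then show ?thesis
        using slide[OF y x, of "- c"] neg False by (auto intro: force_equiv.sym)
    qed
  qed
qed

definition pairing :: "('k \<Rightarrow> real) \<Rightarrow> ('k \<Rightarrow>\<^sub>0 real) \<Rightarrow> real" where
  "pairing g a = (\<Sum>k\<in>Poly_Mapping.keys a. Poly_Mapping.lookup a k * g k)"

lemma pairing_superset:
  "finite S \<Longrightarrow> Poly_Mapping.keys a \<subseteq> S \<Longrightarrow> pairing g a = (\<Sum>k\<in>S. Poly_Mapping.lookup a k * g k)"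
  unfolding pairing_def by (intro sum.mono_neutral_left) (auto simp: in_keys_iff)

lemma pairing_add: "pairing g (a + b) = pairing g a + pairing g b"
proof -
  let ?S = "Poly_Mapping.keys a \<union> Poly_Mapping.keys b"
  have "pairing g (a + b) = (\<Sum>k\<in>?S. Poly_Mapping.lookup (a + b) k * g k)"
    by (intro pairing_superset Poly_Mapping.keys_add) simp
  also have "\<dots> = pairing g a + pairing g b"
    by (simp add: pairing_superset[of ?S] lookup_add distrib_right sum.distrib)
  finally show ?thesis .
qed

lemma pairing_zero: "pairing g 0 = 0"
  by (simp add: pairing_def)

lemma pairing_single: "pairing g (Poly_Mapping.single k r) = r * g k"
  by (simp add: pairing_superset[of "{k}"])

lemma pairing_sum: "pairing g (\<Sum>i\<in>I. a i) = (\<Sum>i\<in>I. pairing g (a i))"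
  by (induction I rule: infinite_finite_induct) (auto simp: pairing_zero pairing_add)

text \<open>
  The power of a system of forces against a Killing field is an invariant of the equivalence. The
  only generator for which this is not linearity is transport, where it is the conservation law along
  geodesics.
\<close>

lemma force_equiv_killing_pairing:
  assumes "force_equiv G a b" and K: "killing_field G K"
  shows "pairing (\<lambda>(x, f). form G f (K x)) a = pairing (\<lambda>(x, f). form G f (K x)) b"
  using assms(1)
proof (induction rule: force_equiv.induct)
  case (transport x f X r)
  then have x: "x \<in> points G" and f: "f \<in> tangent G x" by (auto simp: forces_def)
  have "X = geodesic_velocity G x f" using transport_eq_geodesic_velocity[OF x f] transport by blast
  then show ?case using killing_field_geodesic[OF K x f] by (simp add: pairing_single)
qed (simp_all add: pairing_add pairing_single pairing_zero form.zero_left form.add_left form.scaleR_left)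

text \<open>
  The opposite forces at the ends of an edge are equivalent to zero, so they have no power against
  a Killing field. Hence Killing fields restrict to infinitesimal isometric deformations.
\<close>

lemma killing_field_edge:
  assumes K: "killing_field G K" and x: "x \<in> points G" and y: "y \<in> points G"
  shows "form G (K x) (proj G x y) + form G (K y) (proj G y x) = 0"
  using force_equiv_killing_pairing[OF point_force_slide[OF x y, of 1] K]
    proj_scaleR[of G y "-1" x]
  by (simp add: point_force_def pairing_single form.minus_right form_commute)

section \<open>Equilibrium loads\<close>

text \<open>
  The space spans the ambient space: the points are the coordinate vectors, those other than the
  \<open>0\<close>-th shifted in the direction \<open>0\<close> far enough to lie on the space. The vectors \<open>c k\<close> form the dual basis.
\<close>

lemma basis_of_points:
  "\<exists>(P :: 'n::{finite,zero} \<Rightarrow> 'n rvec) c. (\<forall>k. P k \<in> points G) \<and> (\<forall>v. (\<Sum>k\<in>UNIV. (c k \<bullet> v) *\<^sub>R P k) = v)"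
proof -
  define t where "t = (case G of Euclidean \<Rightarrow> 1 | Spherical \<Rightarrow> 0 | Hyperbolic \<Rightarrow> sqrt 2)"
  define P :: "'n \<Rightarrow> 'n rvec" where "P k = (if k = 0 then axis 0 1 else axis k 1 + axis 0 t)" for k
  define c :: "'n \<Rightarrow> 'n rvec" where
    "c k = (if k = 0 then axis 0 1 - t *\<^sub>R (\<Sum>j\<in>UNIV - {0}. axis j 1) else axis k 1)" for k
  have cv: "c k \<bullet> v = (if k = 0 then v $ 0 - t * (\<Sum>j\<in>UNIV - {0}. v $ j) else v $ k)" for k v
    by (simp add: c_def inner_diff_left inner_sum_left inner_axis')
  have P0: "P k $ 0 = (if k = 0 then 1 else t)" for k
    by (simp add: P_def) (simp add: axis_def)
  have Pl: "P k $ l = (if k = l then 1 else 0)" if "l \<noteq> 0" for k l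
    using that by (auto simp: P_def axis_def)
  have PP: "P k \<bullet> P k = (if k = 0 then 1 else 1 + t\<^sup>2)" for k
    by (simp add: P_def inner_add_left inner_add_right inner_axis_axis power2_eq_square)
  have "P k \<in> points G" for k
    unfolding points_iff coform_def by (cases G) (auto simp: P0 PP t_def curv_def)
  moreover have "(\<Sum>k\<in>UNIV. (c k \<bullet> v) *\<^sub>R P k) = v" for v
  proof (rule vec_eq_iff[THEN iffD2], intro allI)
    fix l
    show "(\<Sum>k\<in>UNIV. (c k \<bullet> v) *\<^sub>R P k) $ l = v $ l"
    proof (cases "l = 0")
      case True
      have "(\<Sum>k\<in>UNIV. (c k \<bullet> v) * P k $ 0) = (c 0 \<bullet> v) * P 0 $ 0 + (\<Sum>k\<in>UNIV - {0}. (c k \<bullet> v) * P k $ 0)"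
        by (rule sum.remove) auto
      also have "\<dots> = v $ 0"
        by (simp add: cv P0 sum_distrib_left mult.commute)
      finally show ?thesis using True by simp
    next
      case False
      have "(\<Sum>k\<in>UNIV. (c k \<bullet> v) * P k $ l) = (\<Sum>k\<in>UNIV. if k = l then v $ l else 0)"
        using False by (intro sum.cong) (auto simp: Pl cv)
      then show ?thesis by simp
    qed
  qed
  ultimately show ?thesis by blast
qed

text \<open>
  The hypothesis says that the bivectors \<open>p\<^sub>i \<and> f\<^sub>i\<close> add up to zero. Expanding the \<open>f\<^sub>i\<close> in a basis of
  points \<open>P\<^sub>a\<close> and sliding replaces every force by forces at the \<open>P\<^sub>a\<close>. Expanding the resulting force
  at \<open>P\<^sub>a\<close> in the basis once more leaves forces between basis points with a coefficient matrix \<open>M\<close>.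
  It is symmetric by the hypothesis, so the forces between \<open>P\<^sub>a\<close> and \<open>P\<^sub>b\<close> cancel after sliding one half of
  them.
\<close>

lemma force_equiv_zeroI:
  fixes p f :: "'v::finite \<Rightarrow> 'n::{finite,zero} rvec"
  assumes p: "\<And>i. p i \<in> points G" and f: "\<And>i. f i \<in> tangent G (p i)"
    and sym: "\<And>m n. (\<Sum>i\<in>UNIV. (n \<bullet> f i) * (m \<bullet> p i)) = (\<Sum>i\<in>UNIV. (m \<bullet> f i) * (n \<bullet> p i))"
  shows "force_equiv G (\<Sum>i\<in>UNIV. Poly_Mapping.single (p i, f i) 1) 0"
proof -
  obtain P c :: "'n \<Rightarrow> 'n rvec" where P: "\<And>k. P k \<in> points G"
    and expand: "\<And>v. (\<Sum>k\<in>UNIV. (c k \<bullet> v) *\<^sub>R P k) = v"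
    using basis_of_points[of G] by metis
  note [trans] = force_equiv.trans
  define w where "w a = (\<Sum>i\<in>UNIV. - (c a \<bullet> f i) *\<^sub>R p i)" for a
  define M where "M a b = c b \<bullet> w a" for a b
  \<comment> \<open>One half of the force between two basis points; the other half is going to be slid.\<close>
  define h where "h a b = point_force G (P a) ((M a b / 2) *\<^sub>R P b)" for a b
  \<comment> \<open>Here the vanishing of the total bivector enters.\<close>
  have M_sym: "M a b = M b a" for a b
    using sym[of "c a" "c b"] by (simp add: M_def w_def inner_sum_right sum_negf)
  have "force_equiv G (Poly_Mapping.single (p i, f i) 1)
      (\<Sum>a\<in>UNIV. point_force G (P a) (- (c a \<bullet> f i) *\<^sub>R p i))" for i
  proof -
    have "Poly_Mapping.single (p i, f i) 1 = point_force G (p i) (\<Sum>a\<in>UNIV. (c a \<bullet> f i) *\<^sub>R P a)"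
      using expand proj_eq_self[OF p f] by (simp add: point_force_def)
    also have "force_equiv G (point_force G (p i) (\<Sum>a\<in>UNIV. (c a \<bullet> f i) *\<^sub>R P a))
        (\<Sum>a\<in>UNIV. point_force G (p i) ((c a \<bullet> f i) *\<^sub>R P a))"
      by (rule force_equiv.sym[OF point_force_sum[OF p]]) simp
    also have "force_equiv G \<dots> (\<Sum>a\<in>UNIV. point_force G (P a) (- (c a \<bullet> f i) *\<^sub>R p i))"
      by (intro force_equiv_sum point_force_slide p P)
    finally show ?thesis .
  qed
  then have "force_equiv G (\<Sum>i\<in>UNIV. Poly_Mapping.single (p i, f i) 1)
      (\<Sum>i\<in>UNIV. \<Sum>a\<in>UNIV. point_force G (P a) (- (c a \<bullet> f i) *\<^sub>R p i))"
    by (rule force_equiv_sum)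
  also have "(\<Sum>i\<in>UNIV. \<Sum>a\<in>UNIV. point_force G (P a) (- (c a \<bullet> f i) *\<^sub>R p i))
      = (\<Sum>a\<in>UNIV. \<Sum>i\<in>UNIV. point_force G (P a) (- (c a \<bullet> f i) *\<^sub>R p i))"
    by (rule sum.swap)
  also have "force_equiv G \<dots> (\<Sum>a\<in>UNIV. point_force G (P a) (w a))"
    unfolding w_def by (intro force_equiv_sum point_force_sum P) simp
  also have "force_equiv G \<dots> (\<Sum>a\<in>UNIV. \<Sum>b\<in>UNIV. h a b + h a b)"
  proof (intro force_equiv_sum)
    fix a
    have "force_equiv G (point_force G (P a) (w a)) (\<Sum>b\<in>UNIV. point_force G (P a) (M a b *\<^sub>R P b))"
      using force_equiv.sym[OF point_force_sum[OF P, of UNIV a "\<lambda>b. M a b *\<^sub>R P b"]] expand[of "w a"]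
      by (simp add: M_def)
    also have "force_equiv G \<dots> (\<Sum>b\<in>UNIV. h a b + h a b)"
    proof (intro force_equiv_sum)
      fix b
      show "force_equiv G (point_force G (P a) (M a b *\<^sub>R P b)) (h a b + h a b)"
        using force_equiv.sym[OF point_force_add[OF P, of a "(M a b / 2) *\<^sub>R P b" "(M a b / 2) *\<^sub>R P b"]]
        by (simp add: h_def flip: scaleR_add_left)
    qed
    finally show "force_equiv G (point_force G (P a) (w a)) (\<Sum>b\<in>UNIV. h a b + h a b)" .
  qed
  also have "(\<Sum>a\<in>UNIV. \<Sum>b\<in>UNIV. h a b + h a b) = (\<Sum>a\<in>UNIV. \<Sum>b\<in>UNIV. h a b + h b a)"
    by (simp only: sum.distrib sum.swap[of "\<lambda>a b. h b a" UNIV UNIV])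
  also have "force_equiv G \<dots> (\<Sum>a\<in>(UNIV::'n set). \<Sum>b\<in>(UNIV::'n set). 0)"
  proof (intro force_equiv_sum)
    fix a b
    have refl: "force_equiv G (h a b) (h a b)"
      by (rule force_equiv.refl) (simp add: h_def point_force_def forces_def P proj_tangent)
    have "force_equiv G (h b a) (point_force G (P a) (- (M a b / 2) *\<^sub>R P b))"
      unfolding h_def M_sym[of b a] by (rule point_force_slide[OF P P])
    then have "force_equiv G (h a b + h b a) (h a b + point_force G (P a) (- (M a b / 2) *\<^sub>R P b))"
      by (rule force_equiv.add[OF refl])
    also have "force_equiv G \<dots> (point_force G (P a) ((M a b / 2) *\<^sub>R P b + - (M a b / 2) *\<^sub>R P b))"
      unfolding h_def by (rule point_force_add[OF P])
    also have "(M a b / 2) *\<^sub>R P b + - (M a b / 2) *\<^sub>R P b = 0" by simp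
    also have "force_equiv G (point_force G (P a) 0) 0" by (rule point_force_zero[OF P])
    finally show "force_equiv G (h a b + h b a) 0" .
  qed
  finally show ?thesis by simp
qed

text \<open>
  Equilibrium loads have no power against any Killing field by invariance; conversely, the
  rotation fields alone suffice to detect the sum of the bivectors \<open>p\<^sub>i \<and> f\<^sub>i\<close>.
\<close>

lemma equilibrium_loads_iff:
  fixes p :: "'v::finite \<Rightarrow> 'n::{finite,zero} rvec"
  assumes p: "\<And>i. p i \<in> points G"
  shows "f \<in> equilibrium_loads G p \<longleftrightarrow> f \<in> tangent_fields G p \<and>
    (\<forall>K. killing_field G K \<longrightarrow> (\<Sum>i\<in>UNIV. form G (f $ i) (K (p i))) = 0)"
proof (intro iffI conjI allI impI)
  assume f: "f \<in> equilibrium_loads G p"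
  then show "f \<in> tangent_fields G p" by (simp add: equilibrium_loads_def)
  fix K :: "'n rvec \<Rightarrow> 'n rvec" assume K: "killing_field G K"
  have "force_equiv G (\<Sum>i\<in>UNIV. Poly_Mapping.single (p i, f $ i) 1) 0"
    using f by (simp add: equilibrium_loads_def)
  from force_equiv_killing_pairing[OF this K]
  show "(\<Sum>i\<in>UNIV. form G (f $ i) (K (p i))) = 0"
    by (simp add: pairing_sum pairing_single pairing_zero)
next
  assume f: "f \<in> tangent_fields G p \<and>
    (\<forall>K. killing_field G K \<longrightarrow> (\<Sum>i\<in>UNIV. form G (f $ i) (K (p i))) = 0)"
  then have ft: "f $ i \<in> tangent G (p i)" for i by (simp add: tangent_fields_def)
  have "(\<Sum>i\<in>UNIV. (n \<bullet> f $ i) * (m \<bullet> p i)) = (\<Sum>i\<in>UNIV. (m \<bullet> f $ i) * (n \<bullet> p i))" for m n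
  proof -
    have "(\<Sum>i\<in>UNIV. form G (f $ i) ((m \<bullet> p i) *\<^sub>R form_dual G n - (n \<bullet> p i) *\<^sub>R form_dual G m)) = 0"
      using f killing_field_rotation by blast
    then show ?thesis
      by (simp add: form.diff_right form.scaleR_right form_dual_tangent[OF p ft] sum_subtractf mult.commute)
  qed
  then have "force_equiv G (\<Sum>i\<in>UNIV. Poly_Mapping.single (p i, f $ i) 1) 0"
    by (intro force_equiv_zeroI p ft)
  then show "f \<in> equilibrium_loads G p" using f by (simp add: equilibrium_loads_def)
qed

section \<open>Trivial deformations\<close>

lemma trivial_deformations_iff:
  assumes fw: "framework G E p"
  shows "q \<in> trivial_deformations G E p \<longleftrightarrow> (\<exists>K. killing_field G K \<and> (\<forall>i. q $ i = K (p i)))"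
proof -
  have p: "p i \<in> points G" for i using fw by (simp add: framework_def)
  have "q \<in> isometric_deformations G E p" if "killing_field G K" "\<forall>i. q $ i = K (p i)" for K
    using that p killing_field_edge[OF that(1) p p]
    by (auto simp: isometric_deformations_iff[OF fw] tangent_fields_def killing_field_def)
  then show ?thesis by (auto simp: trivial_deformations_def)
qed

lemma subspace_trivial_deformations:
  fixes p :: "'v::finite \<Rightarrow> 'n::{finite,zero} rvec"
  assumes fw: "framework G E p"
  shows "subspace (trivial_deformations G E p)"
  unfolding subspace_def trivial_deformations_iff[OF fw]
proof (intro conjI ballI allI)
  show "\<exists>K. killing_field G K \<and> (\<forall>i. (0 :: 'n rvec ^ 'v) $ i = K (p i))"
    using killing_field_zero by (metis zero_index)
next
  fix q r assume "q \<in> trivial_deformations G E p" "r \<in> trivial_deformations G E p"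
  then obtain K L where "killing_field G K" "\<forall>i. q $ i = K (p i)" "killing_field G L" "\<forall>i. r $ i = L (p i)"
    unfolding trivial_deformations_iff[OF fw] by blast
  then show "\<exists>K. killing_field G K \<and> (\<forall>i. (q + r) $ i = K (p i))"
    using killing_field_add by (intro exI[of _ "\<lambda>x. K x + L x"]) auto
next
  fix c q assume "q \<in> trivial_deformations G E p"
  then obtain K where "killing_field G K" "\<forall>i. q $ i = K (p i)"
    unfolding trivial_deformations_iff[OF fw] by blast
  then show "\<exists>K. killing_field G K \<and> (\<forall>i. (c *\<^sub>R q) $ i = K (p i))"
    using killing_field_scaleR by (intro exI[of _ "\<lambda>x. c *\<^sub>R K x"]) auto
qed

section \<open>Dimensions of annihilators and quotients\<close>

text \<open>
  The hyperbolic metric is indefinite on the ambient space, so complements with respect to \<open>b\<close> are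
  available only inside \<open>T\<close>. There \<open>b\<close> is represented against the Euclidean inner product by a
  linear map \<open>A\<close> into \<open>T\<close>, which is injective by positivity.
  The annihilator of \<open>U\<close> is the orthogonal complement of \<open>A ` U\<close> in \<open>T\<close>.
\<close>

lemma dim_annihilator:
  fixes b :: "'a::euclidean_space \<Rightarrow> 'a \<Rightarrow> real"
  assumes b: "bilinear b" and pos: "\<And>f. f \<in> T \<Longrightarrow> f \<noteq> 0 \<Longrightarrow> b f f > 0"
    and T: "subspace T" and U: "subspace U" "U \<subseteq> T"
  shows "dim {q\<in>T. \<forall>f\<in>U. b q f = 0} + dim U = dim T"
proof -
  obtain B where B: "B \<subseteq> T" "pairwise orthogonal B" "\<And>x. x \<in> B \<Longrightarrow> norm x = 1"
      "independent B" "span B = T"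
    using orthonormal_basis_subspace[OF T] by metis
  have fin: "finite B" using B(4) independent_imp_finite by blast
  define A where "A f = (\<Sum>e\<in>B. b e f *\<^sub>R e)" for f
  have A_T: "A f \<in> T" for f
    unfolding A_def using B(1) T by (auto intro!: subspace_sum subspace_scale)
  have repr: "b q f = q \<bullet> A f" if "q \<in> T" for q f
  proof -
    have lin: "linear (\<lambda>x. b x f)" using b by (simp add: bilinear_def)
    have "b q f = b (\<Sum>e\<in>B. (q \<bullet> e) *\<^sub>R e) f"
      using orthonormal_basis_expand[OF B(2,3), of q] that B(5) fin by simp
    also have "\<dots> = (\<Sum>e\<in>B. (q \<bullet> e) * b e f)"
      by (simp add: linear_sum[OF lin] linear_cmul[OF lin])
    finally show ?thesis by (simp add: A_def inner_sum_right mult.commute)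
  qed
  have lin: "linear A"
    using b by (auto intro!: linearI simp: A_def bilinear_radd bilinear_rmul algebra_simps
        sum.distrib scaleR_sum_right)
  have inj: "inj_on A U"
  proof (rule linear_inj_on_iff_eq_0[OF lin U(1), THEN iffD2], intro ballI impI)
    fix f assume "f \<in> U" "A f = 0"
    then show "f = 0" using repr[of f f] pos[of f] U(2) by fastforce
  qed
  have "{q\<in>T. \<forall>f\<in>U. b q f = 0} = {q\<in>T. \<forall>g\<in>A ` U. orthogonal g q}"
    using repr by (auto simp: orthogonal_def inner_commute)
  moreover have "dim {q\<in>T. \<forall>g\<in>A ` U. orthogonal g q} + dim (A ` U) = dim T"
    using A_T by (intro dim_subspace_orthogonal_to_vectors linear_subspace_image lin U T) auto
  moreover have "dim (A ` U) = dim U"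
    using inj lin U(1) by (intro dim_image_eq) (auto simp: span_eq_iff[THEN iffD2])
  ultimately show ?thesis by simp
qed

lemma card_quotient_basis:
  fixes V W :: "'a::euclidean_space set"
  assumes V: "subspace V" and W: "subspace W" "W \<subseteq> V" and Q: "quotient_basis V W B"
  shows "card B + dim W = dim V"
proof -
  have fin: "finite B" and BV: "B \<subseteq> V"
    and indep_mod: "\<And>c. (\<Sum>b\<in>B. c b *\<^sub>R b) \<in> W \<Longrightarrow> \<forall>b\<in>B. c b = 0"
    and span_mod: "\<And>x. x \<in> V \<Longrightarrow> \<exists>c. x - (\<Sum>b\<in>B. c b *\<^sub>R b) \<in> W"
    using Q by (auto simp: quotient_basis_def)
  have "independent B"
    using indep_mod subspace_0[OF W(1)] fin by (metis independent_explicit)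
  then have "dim (span B) = card B" by (simp add: dim_eq_card_independent)
  moreover have "span B \<inter> W = {0}"
  proof -
    have "x = 0" if x_in: "x \<in> span B" "x \<in> W" for x
    proof -
      obtain c where x: "x = (\<Sum>b\<in>B. c b *\<^sub>R b)"
        using x_in(1) by (auto simp: span_finite[OF fin])
      then have "\<forall>b\<in>B. c b = 0" using indep_mod[of c] x_in(2) by simp
      then show ?thesis by (simp add: x)
    qed
    then show ?thesis using span_zero subspace_0[OF W(1)] by blast
  qed
  moreover have "{x + y |x y. x \<in> span B \<and> y \<in> W} = V"
  proof
    show "{x + y |x y. x \<in> span B \<and> y \<in> W} \<subseteq> V"
      using BV V W span_minimal[OF BV V] by (auto intro!: subspace_add)
    show "V \<subseteq> {x + y |x y. x \<in> span B \<and> y \<in> W}"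
    proof
      fix x assume "x \<in> V"
      then obtain c where "x - (\<Sum>b\<in>B. c b *\<^sub>R b) \<in> W" using span_mod by blast
      moreover have "(\<Sum>b\<in>B. c b *\<^sub>R b) \<in> span B"
        by (simp add: span_sum span_scale span_base)
      ultimately show "x \<in> {x + y |x y. x \<in> span B \<and> y \<in> W}"
        by (intro CollectI exI[of _ "\<Sum>b\<in>B. c b *\<^sub>R b"] exI[of _ "x - (\<Sum>b\<in>B. c b *\<^sub>R b)"]) simp
    qed
  qed
  ultimately show ?thesis
    using dim_sums_Int[of "span B" W] W by simp
qed

lemma quotient_basis_exists:
  fixes V W :: "'a::euclidean_space set"
  assumes V: "subspace V" and W: "subspace W" "W \<subseteq> V"
  shows "\<exists>B. quotient_basis V W B"
proof -
  obtain B\<^sub>0 where B\<^sub>0: "B\<^sub>0 \<subseteq> W" "independent B\<^sub>0" "W \<subseteq> span B\<^sub>0"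
    by (rule maximal_independent_subset)
  obtain B where B: "B\<^sub>0 \<subseteq> B" "B \<subseteq> V" "independent B" "V \<subseteq> span B"
    using maximal_independent_subset_extend[of B\<^sub>0 V] B\<^sub>0 W(2) by (metis order_trans)
  have fin: "finite B" using B(3) independent_imp_finite by blast
  have sp: "span B\<^sub>0 = W" using B\<^sub>0 W by (simp add: span_subspace)
  show ?thesis
  proof (intro exI[of _ "B - B\<^sub>0"] quotient_basis_def[THEN iffD2] conjI allI impI)
    fix c assume "(\<Sum>b\<in>B - B\<^sub>0. c b *\<^sub>R b) \<in> W"
    then obtain d where d: "(\<Sum>b\<in>B - B\<^sub>0. c b *\<^sub>R b) = (\<Sum>b\<in>B\<^sub>0. d b *\<^sub>R b)"
      using sp fin B(1) by (auto simp: span_finite finite_subset)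
    have "(\<Sum>b\<in>B. (if b \<in> B\<^sub>0 then - d b else c b) *\<^sub>R b)
        = (\<Sum>b\<in>B - B\<^sub>0. c b *\<^sub>R b) + (\<Sum>b\<in>B\<^sub>0. - d b *\<^sub>R b)"
      using fin B(1) by (simp add: sum.subset_diff)
    then have "(\<Sum>b\<in>B. (if b \<in> B\<^sub>0 then - d b else c b) *\<^sub>R b) = 0"
      using d by (simp add: sum_negf)
    then show "\<forall>b\<in>B - B\<^sub>0. c b = 0"
      using independentD[OF B(3) fin subset_refl] by fastforce
  next
    show "\<forall>x\<in>V. \<exists>c. x - (\<Sum>b\<in>B - B\<^sub>0. c b *\<^sub>R b) \<in> W"
    proof
      fix x assume "x \<in> V"
      then obtain c where "x = (\<Sum>b\<in>B. c b *\<^sub>R b)"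
        using B(4) fin by (auto simp: span_finite)
      then have "x - (\<Sum>b\<in>B - B\<^sub>0. c b *\<^sub>R b) = (\<Sum>b\<in>B\<^sub>0. c b *\<^sub>R b)"
        using fin B(1) by (simp add: sum.subset_diff)
      also have "\<dots> \<in> W" using B\<^sub>0(1) W(1) by (auto intro!: subspace_sum subspace_scale)
      finally show "\<exists>c. x - (\<Sum>b\<in>B - B\<^sub>0. c b *\<^sub>R b) \<in> W" by blast
    qed
  qed (use fin B in auto)
qed

lemma quotient_dim_eq:
  fixes V W :: "'a::euclidean_space set"
  assumes "subspace V" "subspace W" "W \<subseteq> V"
  shows "quotient_dim V W + dim W = dim V"
  unfolding quotient_dim_def
  using card_quotient_basis[OF assms] someI_ex[OF quotient_basis_exists[OF assms]] by blast

section \<open>Duality of kinematics and statics\<close>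

definition work :: "geometry \<Rightarrow> 'n::{finite,zero} rvec ^ 'v::finite \<Rightarrow> 'n rvec ^ 'v \<Rightarrow> real" where
  "work G q f = (\<Sum>i\<in>UNIV. form G (q $ i) (f $ i))"

lemma bilinear_work: "bilinear (work G)"
  by (auto simp: bilinear_def work_def form.add_left form.add_right form.scaleR_left form.scaleR_right
      sum.distrib sum_distrib_left intro!: linearI)

lemma work_commute: "work G q f = work G f q"
  by (simp add: work_def form_commute)

lemma work_pos:
  assumes p: "\<And>i. p i \<in> points G" and f: "f \<in> tangent_fields G p" "f \<noteq> 0"
  shows "work G f f > 0"
proof -
  have ft: "f $ i \<in> tangent G (p i)" for i using f by (simp add: tangent_fields_def)
  obtain i where "f $ i \<noteq> 0" using f(2) by (auto simp: vec_eq_iff)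
  then show ?thesis
    unfolding work_def using form_pos[OF p ft] form_nonneg[OF p ft] by (intro sum_pos2[of _ i]) auto
qed

lemma subspace_tangent_fields:
  assumes "\<And>i. p i \<in> points G"
  shows "subspace (tangent_fields G p)"
  using subspace_tangent[OF assms] by (auto simp: subspace_def tangent_fields_def)

text \<open>
  These loads are defined without reference to equilibrium, which they satisfy as a consequence of the
  duality.
\<close>

definition resolved_loads :: "geometry \<Rightarrow> 'v::finite set set \<Rightarrow> ('v \<Rightarrow> 'n::{finite,zero} rvec) \<Rightarrow> ('n rvec ^ 'v) set" where
  "resolved_loads G E p = {f. \<exists>w. resolves G E p w f}"

lemma resolves_iff:
  assumes fw: "framework G E p"
  shows "resolves G E p w f \<longleftrightarrow> (\<forall>i. f $ i = (\<Sum>j | {i, j} \<in> E.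
    (w {i, j} * (rdist G (p i) (p j) / tnorm G (proj G (p i) (p j)))) *\<^sub>R proj G (p i) (p j)))"
proof -
  have "direction G (p i) (p j) = (1 / tnorm G (proj G (p i) (p j))) *\<^sub>R proj G (p i) (p j)"
    if "{i, j} \<in> E" for i j
    using fw that by (intro direction_eq) (auto simp: framework_def)
  then show ?thesis unfolding resolves_def by simp
qed

lemma subspace_resolved_loads: "subspace (resolved_loads G E p)"
proof (rule subspaceI)
  show "0 \<in> resolved_loads G E p"
    by (auto simp: resolved_loads_def resolves_def intro!: exI[of _ "\<lambda>e. 0"])
next
  fix f g assume "f \<in> resolved_loads G E p" "g \<in> resolved_loads G E p"
  then obtain w u where "resolves G E p w f" "resolves G E p u g"
    by (auto simp: resolved_loads_def)
  then have "resolves G E p (\<lambda>e. w e + u e) (f + g)"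
    by (simp add: resolves_def distrib_right scaleR_add_left sum.distrib)
  then show "f + g \<in> resolved_loads G E p" by (auto simp: resolved_loads_def)
next
  fix c f assume "f \<in> resolved_loads G E p"
  then obtain w where "resolves G E p w f" by (auto simp: resolved_loads_def)
  then have "resolves G E p (\<lambda>e. c * w e) (c *\<^sub>R f)"
    by (simp add: resolves_def scaleR_sum_right mult.assoc)
  then show "c *\<^sub>R f \<in> resolved_loads G E p" by (auto simp: resolved_loads_def)
qed

lemma resolved_loads_tangent:
  assumes fw: "framework G E p"
  shows "resolved_loads G E p \<subseteq> tangent_fields G p"
proof
  fix f assume "f \<in> resolved_loads G E p"
  then obtain w where "resolves G E p w f" by (auto simp: resolved_loads_def)
  moreover have p: "p i \<in> points G" for i using fw by (simp add: framework_def)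
  ultimately show "f \<in> tangent_fields G p"
    unfolding resolves_iff[OF fw] tangent_fields_def
    by (auto intro!: subspace_sum subspace_scale subspace_tangent proj_tangent)
qed

text \<open>
  The work of a resolved load is, up to the sign, the sum over the edges of the stress times one half
  of the rate of change of the squared length. Stresses supported on one edge show that each of these
  rates vanishes if all resolved loads do no work.
\<close>

lemma isometric_deformations_annihilator:
  fixes p :: "'v::finite \<Rightarrow> 'n::{finite,zero} rvec"
  assumes fw: "framework G E p"
  shows "isometric_deformations G E p = {q \<in> tangent_fields G p. \<forall>f\<in>resolved_loads G E p. work G q f = 0}"
proof -
  define k where "k i j = rdist G (p i) (p j) / tnorm G (proj G (p i) (p j))" for i j
  have p: "p i \<in> points G" for i using fw by (simp add: framework_def)
  have ne: "p i \<noteq> p j" "G = Spherical \<longrightarrow> p i \<noteq> - p j" if "{i, j} \<in> E" for i j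
    using fw that by (auto simp: framework_def)
  have k_sym: "k i j = k j i" if "{i, j} \<in> E" for i j
    using tnorm_proj_commute[OF p p ne[OF that]] rdist_commute[of G "p i" "p j"] by (simp add: k_def)
  have k_pos: "k i j > 0" if "{i, j} \<in> E" for i j
    using rdist_properties(3,4)[OF p p ne[OF that]] by (simp add: k_def)
  define s where "s q i j = (if {i, j} \<in> E then k i j * form G (q $ i) (proj G (p i) (p j)) else 0)"
    for q :: "'n rvec ^ 'v" and i j
  have work_eq: "work G q f = (\<Sum>i\<in>UNIV. \<Sum>j\<in>UNIV. w {i, j} * s q i j)" if "resolves G E p w f" for q w f
  proof -
    have "form G (q $ i) (f $ i) = (\<Sum>j\<in>UNIV. w {i, j} * s q i j)" for i
    proof -
      have "form G (q $ i) (f $ i) = (\<Sum>j | {i, j} \<in> E. w {i, j} * s q i j)"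
        using that by (simp add: resolves_iff[OF fw] s_def form.sum_right form.scaleR_right k_def mult.assoc)
      also have "\<dots> = (\<Sum>j\<in>UNIV. w {i, j} * s q i j)"
        by (rule sum.mono_neutral_left) (auto simp: s_def)
      finally show ?thesis .
    qed
    then show ?thesis by (simp add: work_def)
  qed
  \<comment> \<open>Averaging over the two orientations collects both ends of each edge in one term.\<close>
  have work_sym: "work G q f = (\<Sum>i\<in>UNIV. \<Sum>j\<in>UNIV. w {i, j} * (s q i j + s q j i)) / 2"
    if "resolves G E p w f" for q w f
  proof -
    have "(\<Sum>i\<in>UNIV. \<Sum>j\<in>UNIV. w {i, j} * s q j i) = (\<Sum>j\<in>UNIV. \<Sum>i\<in>UNIV. w {i, j} * s q j i)"
      by (rule sum.swap)
    then have "(\<Sum>i\<in>UNIV. \<Sum>j\<in>UNIV. w {i, j} * s q j i) = work G q f"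
      by (simp add: work_eq[OF that] insert_commute)
    then show ?thesis
      by (simp add: distrib_left sum.distrib flip: work_eq[OF that])
  qed
  have s_sum: "s q i j + s q j i = (if {i, j} \<in> E
      then k i j * (form G (q $ i) (proj G (p i) (p j)) + form G (q $ j) (proj G (p j) (p i))) else 0)" for q i j
    using k_sym[of i j] by (auto simp: s_def insert_commute distrib_left)
  show ?thesis
  proof (intro set_eqI iffI)
    fix q assume "q \<in> isometric_deformations G E p"
    then have q: "q \<in> tangent_fields G p" and zero: "s q i j + s q j i = 0" for i j
      unfolding isometric_deformations_iff[OF fw] s_sum by auto
    have "work G q f = 0" if "resolves G E p w f" for w f
      using work_sym[OF that, of q] by (simp add: zero)
    then show "q \<in> {q \<in> tangent_fields G p. \<forall>f\<in>resolved_loads G E p. work G q f = 0}"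
      using q by (auto simp: resolved_loads_def)
  next
    fix q assume q: "q \<in> {q \<in> tangent_fields G p. \<forall>f\<in>resolved_loads G E p. work G q f = 0}"
    have "form G (q $ a) (proj G (p a) (p b)) + form G (q $ b) (proj G (p b) (p a)) = 0"
      if ab: "{a, b} \<in> E" for a b
    proof -
      have "a \<noteq> b" using ne[OF ab] by auto
      \<comment> \<open>The load of a unit stress on the single edge \<open>{a, b}\<close> tests the length of that edge.\<close>
      define w :: "'v set \<Rightarrow> real" where "w e = (if e = {a, b} then 1 else 0)" for e
      define f :: "'n rvec ^ 'v" where "f = (\<chi> i. \<Sum>j | {i, j} \<in> E.
        (w {i, j} * rdist G (p i) (p j)) *\<^sub>R direction G (p i) (p j))"
      have res: "resolves G E p w f" by (simp add: resolves_def f_def)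
      have "0 = work G q f" using q res by (auto simp: resolved_loads_def)
      also have "\<dots> = (\<Sum>(i, j)\<in>UNIV. w {i, j} * s q i j)"
        by (simp add: work_eq[OF res] sum.cartesian_product)
      also have "\<dots> = (\<Sum>(i, j)\<in>{(a, b), (b, a)}. w {i, j} * s q i j)"
        by (rule sum.mono_neutral_right) (auto simp: w_def doubleton_eq_iff split: if_splits)
      also have "\<dots> = s q a b + s q b a"
        using \<open>a \<noteq> b\<close> by (simp add: w_def insert_commute)
      finally show ?thesis using k_pos[OF ab] ab by (simp add: s_sum)
    qed
    then show "q \<in> isometric_deformations G E p"
      using q by (simp add: isometric_deformations_iff[OF fw])
  qed
qed

lemma equilibrium_loads_annihilator:
  fixes p :: "'v::finite \<Rightarrow> 'n::{finite,zero} rvec"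
  assumes fw: "framework G E p"
  shows "equilibrium_loads G p = {f \<in> tangent_fields G p. \<forall>q\<in>trivial_deformations G E p. work G f q = 0}"
proof -
  have p: "p i \<in> points G" for i using fw by (simp add: framework_def)
  have "(\<forall>q\<in>trivial_deformations G E p. work G f q = 0) \<longleftrightarrow>
    (\<forall>K. killing_field G K \<longrightarrow> (\<Sum>i\<in>UNIV. form G (f $ i) (K (p i))) = 0)" for f
  proof (intro iffI ballI allI impI)
    fix K :: "'n rvec \<Rightarrow> 'n rvec" assume "\<forall>q\<in>trivial_deformations G E p. work G f q = 0" "killing_field G K"
    moreover from this have "(\<chi> i. K (p i)) \<in> trivial_deformations G E p"
      by (auto simp: trivial_deformations_iff[OF fw])
    ultimately show "(\<Sum>i\<in>UNIV. form G (f $ i) (K (p i))) = 0"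
      by (fastforce simp: work_def)
  qed (auto simp: trivial_deformations_iff[OF fw] work_def)
  then show ?thesis by (auto simp: equilibrium_loads_iff[OF p])
qed

section \<open>Kinematic and static degrees of freedom\<close>

theorem theoremA:
  fixes G :: geometry
    and E :: "'v::finite set set"
    and p :: "'v \<Rightarrow> 'n::{finite,zero} rvec"
  assumes "framework G E p"
  shows "kinematic_dof G E p = static_dof G E p
    \<and> (infinitesimally_rigid G E p \<longleftrightarrow> statically_rigid G E p)"
proof -
  let ?T = "tangent_fields G p" and ?V = "isometric_deformations G E p" and ?Vtriv = "trivial_deformations G E p"
    and ?F = "equilibrium_loads G p" and ?Fres = "resolvable_loads G E p"
  have p: "p i \<in> points G" for i using assms by (simp add: framework_def)
  note T = subspace_tangent_fields[of p, OF p]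
  note V = isometric_deformations_annihilator[OF assms]
  note F = equilibrium_loads_annihilator[OF assms]
  have V0_V: "?Vtriv \<subseteq> ?V" by (auto simp: trivial_deformations_def)
  have V_T: "?V \<subseteq> ?T" using V by blast
  have "work G f q = 0" if "f \<in> resolved_loads G E p" "q \<in> ?Vtriv" for f q
    using that V0_V V work_commute[of G f q] by auto
  then have R_F: "resolved_loads G E p \<subseteq> ?F"
    using resolved_loads_tangent[OF assms] unfolding F by blast
  have F0: "?Fres = resolved_loads G E p"
    using R_F by (auto simp: resolvable_loads_def resolved_loads_def)
  have annihilator: "subspace {q\<in>?T. \<forall>f\<in>U. work G q f = 0}" for U
    using T by (auto simp: subspace_def bilinear_lzero[OF bilinear_work]
        bilinear_ladd[OF bilinear_work] bilinear_lmul[OF bilinear_work])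
  have "dim ?V + dim ?Fres = dim ?T"
    unfolding F0 V using resolved_loads_tangent[OF assms] subspace_resolved_loads
    by (intro dim_annihilator bilinear_work work_pos[OF p] T)
  moreover have "dim ?F + dim ?Vtriv = dim ?T"
    unfolding F using V0_V V_T subspace_trivial_deformations[OF assms]
    by (intro dim_annihilator bilinear_work work_pos[OF p] T) auto
  moreover have "quotient_dim ?V ?Vtriv + dim ?Vtriv = dim ?V"
    using annihilator[of "resolved_loads G E p"] subspace_trivial_deformations[OF assms] V0_V
    by (intro quotient_dim_eq) (simp_all add: V)
  moreover have "quotient_dim ?F ?Fres + dim ?Fres = dim ?F"
    using annihilator[of ?Vtriv] subspace_resolved_loads R_F by (intro quotient_dim_eq) (simp_all add: F F0)
  ultimately have "kinematic_dof G E p = static_dof G E p"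
    by (simp add: kinematic_dof_def static_dof_def)
  then show ?thesis by (simp add: infinitesimally_rigid_def statically_rigid_def)
qed

end
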